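(* Let $q>3$ be an odd prime power, $n\ge1$, $k=\mathbb{F}_q$, $K=\mathbb{F}_{q^2}$, $A_n=M_n(K)$ with involution $(a^* )_{ij}=\overline{a_{ji}}$. Let $E$ be the underlying $k$-vector space of $K^{2n}$, with the symplectic form $j$ defined in the context, so that $SL_*^{-1}(2,A_n)\cong U(n,n)(K/k)$ is embedded in $Sp(E,j)$. Let $\psi$ be a nontrivial character of $K^+$ with $\psi(\lambda)=\psi(\overline\lambda)$ for all $\lambda\in K$, and let $\varphi$ be the character of $K^+$ with $\varphi(-2\lambda)=\psi(\lambda)$ for all $\lambda\in K$. Then the restriction to $SL_*^{-1}(2,A_n)$ of the Weil representation of $Sp(E,j)$ attached to $\varphi$ is equivalent to the generalized Weil representation $(\mathbb{C}^M,\rho)$ of $SL_*^{-1}(2,A_n)$ attached to $\psi$ that is described in the context.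
   Context: Here $\lambda\mapsto\overline{\lambda}$ is the nontrivial $k$-automorphism of $K$; for a row vector $y$ over $K$, $y^*$ is the conjugate transpose. **The group.** $SL_*^{-1}(2,A_n)$ is the group, under matrix multiplication, of all matrices $\begin{pmatrix}a&b\\ c&d\end{pmatrix}$ with entries in $A_n$ satisfying $a^*c=c^*a$, $ab^*=ba^*$, $b^*d=d^*b$, $cd^*=dc^*$, and $ad^*-bc^*=a^*d-c^*b=1$. Viewed as $2n\times2n$ matrices over $K$ acting on row vectors in $K^{2n}$ by right multiplication, it is the isometry group of the nondegenerate skew-hermitian form $i(x,y)=xJ_-y^*$, $J_-=\begin{pmatrix}0&I_n\\ -I_n&0\end{pmatrix}$, and it is isomorphic to $U(n,n)(K/k)$, the isometry group of the hermitian form $x\begin{pmatrix}0&I_n\\ I_n&0\end{pmatrix}y^*$ on $K^{2n}$. The $k$-bilinear form $j(x,y)=i(x,y)-i(y,x)$ is a nondegenerate $k$-valued symplectic form on $E$, and isometries of $i$ are isometries of $j$; this gives the embedding in $Sp(E,j)$, which acts on $E$ on the right. **Weil representation of $Sp(E,j)$ attached to $\varphi$.** Let $H=E\times k$ with product $(x,s)(y,t)=(x+y,\,s+t+\tfrac12 j(x,y))$, and let $\eta$ be the irreducible complex representation of $H$, unique up to equivalence, in which $(0,s)$ acts by the scalar $\varphi(s)$ for $s\in k$. The Weil representation $W$ is the unique representation of $Sp(E,j)$ on the space of $\eta$ with $W(g)\eta(x,s)W(g)^{-1}=\eta(xg^{-1},s)$ for all $g\in Sp(E,j)$, $(x,s)\in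 H$. **The representation $(\mathbb{C}^M,\rho)$.** Let $M=K^n$ (row vectors, right $A_n$-module), $\langle x,y\rangle=xy^*$, $\chi(x,y)=\psi(\langle x,y\rangle)$, $\gamma(u,x)=\psi(2^{-1}\langle xu,x\rangle)$ for $u\in A_n$ with $u^*=u$, $\alpha(t)=\mathrm{sgn}(\det t)$ for $t\in A_n^\times$ with $\mathrm{sgn}$ the nontrivial quadratic character of $K^\times$, and $c=-1/q^n$. For $a\in M$ let $e_a\in\mathbb{C}^M$ be the delta function at $a$. The group $SL_*^{-1}(2,A_n)$ is generated by $h_t=\begin{pmatrix}t&0\\ 0&(t^* )^{-1}\end{pmatrix}$ ($t\in A_n^\times$), $w=\begin{pmatrix}0&1\\ -1&0\end{pmatrix}$, $u_s=\begin{pmatrix}1&s\\ 0&1\end{pmatrix}$ ($s\in A_n$, $s^*=s$), and $\rho$ is the representation of it on $\mathbb{C}^M$ given on these generators by $\rho_{u_s}(e_a)=\gamma(s,a)e_a$, $\rho_{h_t}(e_a)=\alpha(t)e_{at^{-1}}$, $\rho_w(e_a)=c\sum_{b\in M}\chi(a,b)e_b$.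
   Formalization: For even n no representation ρ with c = -1/q^n exists (the relations force c = (-1)^n/q^n), so the formal theorem admits c = (-1)^n/q^n as well as the literal c = -1/q^n; the two agree for odd n. *)

theory Defs
  imports "HOL-Analysis.Analysis" "HOL-Algebra.Group" "HOL-Number_Theory.Prime_Powers"
begin

section \<open>A field, a subfield and a nontrivial automorphism over it\<close>

definition is_subfield :: "'K::field set \<Rightarrow> bool" where
  "is_subfield k \<longleftrightarrow> 0 \<in> k \<and> 1 \<in> k \<and>
     (\<forall>x\<in>k. \<forall>y\<in>k. x + y \<in> k \<and> x - y \<in> k \<and> x * y \<in> k) \<and> (\<forall>x\<in>k. inverse x \<in> k)"

definition nontrivial_automorphism_over :: "'K::field set \<Rightarrow> ('K \<Rightarrow> 'K) \<Rightarrow> bool" where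
  "nontrivial_automorphism_over k cj \<longleftrightarrow> bij cj \<and>
     (\<forall>x y. cj (x + y) = cj x + cj y) \<and> (\<forall>x y. cj (x * y) = cj x * cj y) \<and>
     (\<forall>x\<in>k. cj x = x) \<and> cj \<noteq> id"

definition additive_character :: "('K::field \<Rightarrow> complex) \<Rightarrow> bool" where
  "additive_character \<psi> \<longleftrightarrow> \<psi> 0 = 1 \<and> (\<forall>x y. \<psi> (x + y) = \<psi> x * \<psi> y)"

text \<open>The value at 0 is irrelevant.\<close>

definition nontrivial_quadratic_character :: "('K::field \<Rightarrow> complex) \<Rightarrow> bool" where
  "nontrivial_quadratic_character sg \<longleftrightarrow>
     (\<forall>x y. x \<noteq> 0 \<longrightarrow> y \<noteq> 0 \<longrightarrow> sg (x * y) = sg x * sg y) \<and>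
     (\<forall>x. x \<noteq> 0 \<longrightarrow> (sg x)\<^sup>2 = 1) \<and> (\<exists>x. x \<noteq> 0 \<and> sg x \<noteq> 1)"


section \<open>Complex representations\<close>

text \<open>A complex vector space is a type with a scalar multiplication \<open>s\<close> satisfying
  \<^locale>\<open>vector_space\<close>; this is part of \<open>Vector_Spaces.linear s s\<close>.\<close>

definition representation ::
    "('g, 'm) monoid_scheme \<Rightarrow> (complex \<Rightarrow> 'v \<Rightarrow> 'v::ab_group_add) \<Rightarrow> ('g \<Rightarrow> 'v \<Rightarrow> 'v) \<Rightarrow> bool" where
  "representation G s R \<longleftrightarrow> vector_space s \<and>
     (\<forall>g\<in>carrier G. Vector_Spaces.linear s s (R g)) \<and>
     R \<one>\<^bsub>G\<^esub> = id \<and>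
     (\<forall>g\<in>carrier G. \<forall>h\<in>carrier G. R (g \<otimes>\<^bsub>G\<^esub> h) = R g \<circ> R h)"

definition irreducible_representation ::
    "('g, 'm) monoid_scheme \<Rightarrow> (complex \<Rightarrow> 'v \<Rightarrow> 'v::ab_group_add) \<Rightarrow> ('g \<Rightarrow> 'v \<Rightarrow> 'v) \<Rightarrow> bool" where
  "irreducible_representation G s R \<longleftrightarrow> representation G s R \<and> (\<exists>v::'v. v \<noteq> 0) \<and>
     (\<forall>S. module.subspace s S \<and> (\<forall>g\<in>carrier G. R g ` S \<subseteq> S) \<longrightarrow> S = {0} \<or> S = UNIV)"

definition equivalent_representations ::
    "('g, 'm) monoid_scheme \<Rightarrow> (complex \<Rightarrow> 'v \<Rightarrow> 'v::ab_group_add) \<Rightarrow> ('g \<Rightarrow> 'v \<Rightarrow> 'v) \<Rightarrow>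
     (complex \<Rightarrow> 'w \<Rightarrow> 'w::ab_group_add) \<Rightarrow> ('g \<Rightarrow> 'w \<Rightarrow> 'w) \<Rightarrow> bool" where
  "equivalent_representations G s R s' R' \<longleftrightarrow>
     representation G s R \<and> representation G s' R' \<and>
     (\<exists>T. Vector_Spaces.linear s s' T \<and> bij T \<and> (\<forall>g\<in>carrier G. T \<circ> R g = R' g \<circ> T))"


section \<open>The group of two by two matrices over the involutive matrix ring\<close>

definition mstar :: "('K \<Rightarrow> 'K) \<Rightarrow> 'K^'n^'n \<Rightarrow> 'K^'n^'n" where
  "mstar cj a = (\<chi> i j. cj (a $ j $ i))"

text \<open>\<open>block a b c d\<close> is the matrix with rows \<open>(a, b)\<close> and \<open>(c, d)\<close>. Using matrices of double
  size makes \<open>**\<close> the right product.\<close>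

definition block :: "'K^'n^'n \<Rightarrow> 'K^'n^'n \<Rightarrow> 'K^'n^'n \<Rightarrow> 'K^'n^'n \<Rightarrow> 'K^('n + 'n)^('n + 'n)" where
  "block a b c d = (\<chi> i j. case i of
       Inl i' \<Rightarrow> (case j of Inl j' \<Rightarrow> a $ i' $ j' | Inr j' \<Rightarrow> b $ i' $ j')
     | Inr i' \<Rightarrow> (case j of Inl j' \<Rightarrow> c $ i' $ j' | Inr j' \<Rightarrow> d $ i' $ j'))"

definition SL_star :: "('K::field \<Rightarrow> 'K) \<Rightarrow> ('K^('n::finite + 'n)^('n + 'n)) monoid" where
  "SL_star cj = \<lparr>
     carrier = {block a b c d | a b c d.
        mstar cj a ** c = mstar cj c ** a \<and> a ** mstar cj b = b ** mstar cj a \<and>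
        mstar cj b ** d = mstar cj d ** b \<and> c ** mstar cj d = d ** mstar cj c \<and>
        a ** mstar cj d - b ** mstar cj c = mat 1 \<and>
        mstar cj a ** d - mstar cj c ** b = mat 1},
     monoid.mult = (**), one = mat 1\<rparr>"

definition h_elt :: "('K::field \<Rightarrow> 'K) \<Rightarrow> 'K^'n^'n \<Rightarrow> 'K^('n::finite + 'n)^('n + 'n)" where
  "h_elt cj t = block t 0 0 (matrix_inv (mstar cj t))"

definition w_elt :: "'K::field^('n::finite + 'n)^('n + 'n)" where
  "w_elt = block 0 (mat 1) (- mat 1) 0"

definition u_elt :: "'K::field^'n^'n \<Rightarrow> 'K^('n::finite + 'n)^('n + 'n)" where
  "u_elt s = block (mat 1) s 0 (mat 1)"


section \<open>The symplectic space, its Heisenberg group and its Weil representation\<close>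

definition skew_hermitian_form ::
    "('K::field \<Rightarrow> 'K) \<Rightarrow> 'K^('n::finite + 'n) \<Rightarrow> 'K^('n + 'n) \<Rightarrow> 'K" where
  "skew_hermitian_form cj x y =
     (\<Sum>i\<in>UNIV. (x v* block 0 (mat 1) (- mat 1) 0) $ i * cj (y $ i))"

definition symplectic_form ::
    "('K::field \<Rightarrow> 'K) \<Rightarrow> 'K^('n::finite + 'n) \<Rightarrow> 'K^('n + 'n) \<Rightarrow> 'K" where
  "symplectic_form cj x y = skew_hermitian_form cj x y - skew_hermitian_form cj y x"

text \<open>The symplectic group acts on the right, so \<open>x(fg) = (xf)g\<close> and the product of \<open>f\<close> and \<open>g\<close>
  is the map \<open>g \<circ> f\<close>.\<close>

definition Sp :: "'K::field set \<Rightarrow> ('K \<Rightarrow> 'K) \<Rightarrow> ('K^('n::finite + 'n) \<Rightarrow> 'K^('n + 'n)) monoid" where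
  "Sp k cj = \<lparr>
     carrier = {g. bij g \<and> (\<forall>x y. g (x + y) = g x + g y) \<and> (\<forall>c\<in>k. \<forall>x. g (c *s x) = c *s g x) \<and>
        (\<forall>x y. symplectic_form cj (g x) (g y) = symplectic_form cj x y)},
     monoid.mult = (\<lambda>f g. g \<circ> f), one = id\<rparr>"

definition Heisenberg :: "'K::field set \<Rightarrow> ('K \<Rightarrow> 'K) \<Rightarrow> (('K^('n::finite + 'n)) \<times> 'K) monoid" where
  "Heisenberg k cj = \<lparr>
     carrier = UNIV \<times> k,
     monoid.mult = (\<lambda>(x, s) (y, t). (x + y, s + t + symplectic_form cj x y / 2)),
     one = (0, 0)\<rparr>"

text \<open>\<open>\<eta>\<close> is the irreducible representation of the Heisenberg group with central character
  \<open>\<phi>\<close>, and \<open>W\<close> is the Weil representation on its space. The point \<open>xg\<^sup>-\<^sup>1\<close>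
  is \<open>Hilbert_Choice.inv g x\<close>.\<close>

definition Weil_representation ::
    "'K::field set \<Rightarrow> ('K \<Rightarrow> 'K) \<Rightarrow> ('K \<Rightarrow> complex) \<Rightarrow> (complex \<Rightarrow> 'v \<Rightarrow> 'v::ab_group_add) \<Rightarrow>
     (('K^('n::finite + 'n)) \<times> 'K \<Rightarrow> 'v \<Rightarrow> 'v) \<Rightarrow>
     (('K^('n + 'n) \<Rightarrow> 'K^('n + 'n)) \<Rightarrow> 'v \<Rightarrow> 'v) \<Rightarrow> bool" where
  "Weil_representation k cj \<phi> s \<eta> W \<longleftrightarrow>
     irreducible_representation (Heisenberg k cj) s \<eta> \<and>
     (\<forall>t\<in>k. \<eta> (0, t) = s (\<phi> t)) \<and>
     representation (Sp k cj) s W \<and>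
     (\<forall>g\<in>carrier (Sp k cj). \<forall>x. \<forall>t\<in>k.
        W g \<circ> \<eta> (x, t) \<circ> Hilbert_Choice.inv (W g) = \<eta> (Hilbert_Choice.inv g x, t))"

definition matrix_action :: "'K::field^'m^'m \<Rightarrow> 'K^'m \<Rightarrow> 'K^'m" where
  "matrix_action A = (\<lambda>x. x v* A)"


section \<open>The generalized Weil representation\<close>

definition herm :: "('K::field \<Rightarrow> 'K) \<Rightarrow> 'K^'n \<Rightarrow> 'K^'n \<Rightarrow> 'K" where
  "herm cj x y = (\<Sum>i\<in>UNIV. x $ i * cj (y $ i))"

definition chi_fun :: "('K::field \<Rightarrow> 'K) \<Rightarrow> ('K \<Rightarrow> complex) \<Rightarrow> 'K^'n \<Rightarrow> 'K^'n \<Rightarrow> complex" where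
  "chi_fun cj \<psi> x y = \<psi> (herm cj x y)"

definition gamma_fun :: "('K::field \<Rightarrow> 'K) \<Rightarrow> ('K \<Rightarrow> complex) \<Rightarrow> 'K^'n^'n \<Rightarrow> 'K^'n \<Rightarrow> complex" where
  "gamma_fun cj \<psi> u x = \<psi> (inverse 2 * herm cj (x v* u) x)"

text \<open>The space of complex functions on \<open>M\<close> is \<open>complex^('K^'n)\<close>; the delta function at \<open>a\<close> is
  \<open>axis a 1\<close>.\<close>

definition generalized_Weil_representation ::
    "('K::{field,finite} \<Rightarrow> 'K) \<Rightarrow> ('K \<Rightarrow> complex) \<Rightarrow> ('K \<Rightarrow> complex) \<Rightarrow> complex \<Rightarrow>
     ('K^('n::finite + 'n)^('n + 'n) \<Rightarrow> complex^('K^'n) \<Rightarrow> complex^('K^'n)) \<Rightarrow> bool" where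
  "generalized_Weil_representation cj sg \<psi> c \<rho> \<longleftrightarrow>
     representation (SL_star cj) (*s) \<rho> \<and>
     (\<forall>s a. mstar cj s = s \<longrightarrow> \<rho> (u_elt s) (axis a 1) = gamma_fun cj \<psi> s a *s axis a 1) \<and>
     (\<forall>t a. invertible t \<longrightarrow>
        \<rho> (h_elt cj t) (axis a 1) = sg (det t) *s axis (a v* matrix_inv t) 1) \<and>
     (\<forall>a. \<rho> w_elt (axis a 1) = c *s (\<Sum>b\<in>UNIV. chi_fun cj \<psi> a b *s axis b 1))"

text \<open>The usual normalization of the scalar \<open>c\<close> is \<open>-1/q^n\<close>. For odd \<open>n\<close> it equals
  \<open>(-1)^n/q^n\<close>. For even \<open>n\<close> only \<open>(-1)^n/q^n\<close> is compatible with the relation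
  \<open>w u\<^sub>s w = h\<^sub>t u\<^sub>-\<^sub>s w u\<^sub>t\<close>, \<open>t = -s\<^sup>-\<^sup>1\<close>: it forces \<open>c\<close> times the Gauss sum of
  \<open>gamma_fun cj \<psi> s\<close>, which is \<open>(-q)^n\<close>, to be 1. Both values are admitted.\<close>

definition admissible_scalar :: "nat \<Rightarrow> nat \<Rightarrow> complex \<Rightarrow> bool" where
  "admissible_scalar q n c \<longleftrightarrow> c = - 1 / of_nat q ^ n \<or> c = (- 1) ^ n / of_nat q ^ n"

end

theory Submission
  imports Defs
begin

text \<open>
  The space \<open>E\<close> of pairs \<open>(x, y)\<close> with \<open>x, y \<in> M\<close> is the sum of the Lagrangians \<open>{(x, 0)}\<close> and
  \<open>{(0, y)}\<close>. In the space of \<open>\<eta>\<close> there is, up to a scalar, one vector fixed by the second Lagrangian,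
  and its translates \<open>b x\<close> by the first one form a basis: they span because \<open>\<eta>\<close> is irreducible, and
  they are independent because the second Lagrangian acts on them by different characters
  (\<open>exists_Y_invariant\<close>, \<open>comb_surj\<close>, \<open>comb_eqD\<close>, \<open>Y_invariant\<close>). Covariance with \<open>\<eta>\<close> then determines
  \<open>W g\<close> in this basis up to one scalar: a shear \<open>(x, y) \<mapsto> (x, y + f x)\<close> is diagonal, the exchange
  \<open>(x, y) \<mapsto> (-y, x)\<close> is a Fourier transform, and a map preserving both Lagrangians permutes the basis
  (\<open>W_shear\<close>, \<open>W_exchange\<close>, \<open>W_hscale\<close>). These are the formulas for \<open>\<rho>\<close> on \<open>u\<^sub>s\<close>, \<open>w\<close> and \<open>h\<^sub>t\<close>, with the
  opposite sign of the hermitian form. Sending \<open>e\<^sub>a\<close> to \<open>b (\<kappa>a)\<close>, where \<open>\<kappa>\<close> has norm \<open>-1\<close>, corrects the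
  sign and gives the equivalence.

  It remains to see that the scalars are the right ones.

  For a shear, conjugation by \<open>r \<in> k\<close> multiplies \<open>f\<close> by \<open>r\<^sup>2\<close>; as \<open>q > 3\<close> there is such an \<open>r\<close> with
  \<open>r\<^sup>2 - 1\<close> invertible, which forces the scalar to be 1 (\<open>W_shear_v0\<close>).

  For \<open>w\<close>, a relation in \<open>w\<close> and the \<open>u\<^sub>s\<close> has \<open>w\<close> once on the left and twice on the right, so a scalar
  by which the two actions of \<open>w\<close> differ equals its own square (\<open>intertwines_w\<close>).

  For \<open>h\<^sub>t\<close>, the scalar is a character of \<open>GL\<^sub>n(K)\<close>, hence determined by its values on the dilations
  (\<open>GL_character_eqI\<close>), and it has to be \<open>sgn(det t)\<close>. Relations inside the unitary group cannot show
  this, since that group has characters of its own. But the dilation by \<open>d\<close> is a product of two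
  conjugate-linear maps that are symmetric for the trace form and thus give elements of \<open>Sp(E, j)\<close>. For
  every symmetric \<open>S\<close> a relation in \<open>Sp(E, j)\<close> expresses the scalar of \<open>S\<close> by the inverse of the Gauss sum
  of \<open>\<psi>(\<langle>x, Sx\<rangle>/2)\<close> (\<open>W_symmetric_scalar\<close>), and the Gauss sums of the two maps differ by the factor
  \<open>sgn d\<close> (\<open>gauss_sum_scaled\<close>).

  So the two actions agree on the \<open>u\<^sub>s\<close>, \<open>w\<close> and \<open>h\<^sub>t\<close>, which generate the group: for a group element with
  first row \<open>(a, b)\<close> there is a hermitian \<open>s\<close> such that \<open>a + bs\<close> is invertible, and elements whose upper
  left block is invertible factor triangularly (\<open>SL_star_generated\<close>).
\<close>

section \<open>Matrices over a ring with involution\<close>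

lemma matrix_inv_mult:
  assumes "invertible A"
  shows "A ** matrix_inv A = mat 1" "matrix_inv A ** A = mat 1"
  using someI_ex[OF assms[unfolded invertible_def]] unfolding matrix_inv_def by blast+

lemma matrix_inv_eqI:
  fixes A B :: "'K::field^'n^'n"
  assumes "A ** B = mat 1"
  shows "matrix_inv A = B"
proof -
  have "B ** A = mat 1" using assms by (simp add: matrix_left_right_inverse)
  hence "invertible A" using assms unfolding invertible_def by blast
  hence "A ** matrix_inv A = mat 1" "matrix_inv A ** A = mat 1"
    by (simp_all add: matrix_inv_mult)
  thus ?thesis
    by (metis \<open>B ** A = mat 1\<close> matrix_mul_assoc matrix_mul_lid matrix_mul_rid)
qed

lemma matrix_neg_mult:
  fixes A :: "'K::ring_1^'n^'m" and B :: "'K^'l^'n"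
  shows "(- A) ** B = - (A ** B)" "A ** (- B) = - (A ** B)"
  by (simp_all add: matrix_matrix_mult_def vec_eq_iff sum_negf)

lemma vector_matrix_neg:
  fixes A :: "'K::comm_ring_1^'n^'m" and x :: "'K^'m"
  shows "x v* (- A) = - (x v* A)" "(- x) v* A = - (x v* A)"
  by (simp_all add: vector_matrix_mult_def vec_eq_iff sum_negf)

lemma sum_UNIV_Plus:
  fixes f :: "'a::finite + 'b::finite \<Rightarrow> 'c::comm_monoid_add"
  shows "sum f UNIV = (\<Sum>i\<in>UNIV. f (Inl i)) + (\<Sum>i\<in>UNIV. f (Inr i))"
  by (simp add: UNIV_Plus_UNIV[symmetric] sum.Plus del: UNIV_Plus_UNIV)

definition hpair :: "'K^'n \<Rightarrow> 'K^'n \<Rightarrow> 'K^('n::finite + 'n)" where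
  "hpair x y = (\<chi> i. case i of Inl i' \<Rightarrow> x $ i' | Inr i' \<Rightarrow> y $ i')"

lemma hpair_exhaust: obtains x y where "z = hpair x y"
proof
  show "z = hpair (\<chi> i. z $ Inl i) (\<chi> i. z $ Inr i)"
    by (auto simp: hpair_def vec_eq_iff split: sum.split)
qed

lemma hpair_eq_iff [simp]: "hpair x y = hpair x' y' \<longleftrightarrow> x = x' \<and> y = y'"
  by (auto simp: hpair_def vec_eq_iff split: sum.splits)

lemma hpair_add [simp]: "hpair x y + hpair x' y' = hpair (x + x') (y + y')"
  and hpair_scale [simp]: "a *s hpair x y = hpair (a *s x) (a *s y)"
  by (auto simp: hpair_def vec_eq_iff split: sum.split)

lemma hpair_zero [simp]: "hpair 0 0 = 0"
  by (auto simp: hpair_def vec_eq_iff split: sum.split)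

lemma hpair_times_block [simp]:
  "hpair x y v* block a b c d = hpair (x v* a + y v* c) (x v* b + y v* d)"
  by (auto simp: hpair_def block_def vec_eq_iff vector_matrix_mult_def sum_UNIV_Plus split: sum.split)

lemma block_mult:
  "block a b c d ** block a' b' c' d'
     = block (a ** a' + b ** c') (a ** b' + b ** d') (c ** a' + d ** c') (c ** b' + d ** d')"
  by (auto simp: block_def vec_eq_iff matrix_matrix_mult_def sum_UNIV_Plus split: sum.split)

lemma block_eq_iff:
  "block a b c d = block a' b' c' d' \<longleftrightarrow> a = a' \<and> b = b' \<and> c = c' \<and> d = d'"
  by (auto simp: block_def vec_eq_iff split: sum.splits)

lemma block_exhaust: obtains a b c d where "A = block a b c d"
proof
  show "A = block (\<chi> i j. A $ Inl i $ Inl j) (\<chi> i j. A $ Inl i $ Inr j)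
      (\<chi> i j. A $ Inr i $ Inl j) (\<chi> i j. A $ Inr i $ Inr j)"
    by (auto simp: block_def vec_eq_iff split: sum.split)
qed

lemma block_one: "block (mat 1) 0 0 (mat 1) = mat 1"
  by (auto simp: block_def vec_eq_iff mat_def split: sum.split)

locale field_involution =
  fixes cj :: "'K::field \<Rightarrow> 'K"
  assumes cj_add: "cj (x + y) = cj x + cj y"
    and cj_mult: "cj (x * y) = cj x * cj y"
    and cj_cj [simp]: "cj (cj x) = x"
begin

lemma cj_0 [simp]: "cj 0 = 0"
  using cj_add[of 0 0] by (metis add.right_neutral add_left_cancel)

lemma cj_1 [simp]: "cj 1 = 1"
  by (metis cj_cj cj_mult mult.left_neutral mult.commute)

lemma cj_minus: "cj (- x) = - cj x"
  using cj_add[of x "- x"] by (simp add: eq_neg_iff_add_eq_0 add.commute)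

lemma cj_diff: "cj (x - y) = cj x - cj y"
  using cj_add[of x "- y"] by (simp add: cj_minus)

lemma cj_sum: "cj (sum f A) = (\<Sum>i\<in>A. cj (f i))"
  by (induction A rule: infinite_finite_induct) (simp_all add: cj_add)

lemma cj_eq_0_iff [simp]: "cj x = 0 \<longleftrightarrow> x = 0"
  by (metis cj_cj cj_0)

lemma cj_inverse: "cj (inverse x) = inverse (cj x)"
proof (cases "x = 0")
  case False
  hence "cj x * cj (inverse x) = 1"
    by (simp flip: cj_mult)
  thus ?thesis by (rule inverse_unique[symmetric])
qed simp

lemma cj_of_nat [simp]: "cj (of_nat m) = of_nat m"
  by (induction m) (simp_all add: cj_add)

lemma cj_numeral [simp]: "cj (numeral m) = numeral m"
  using cj_of_nat[of "numeral m"] by simp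

lemma mstar_mult: "mstar cj (a ** b) = mstar cj b ** mstar cj a"
  by (simp add: mstar_def matrix_matrix_mult_def vec_eq_iff cj_sum cj_mult mult.commute)

lemma mstar_mstar [simp]: "mstar cj (mstar cj a) = a"
  by (simp add: mstar_def vec_eq_iff)

lemma mstar_mat [simp]: "mstar cj (mat 1) = mat 1"
  by (simp add: mstar_def mat_def vec_eq_iff)

lemma mstar_0 [simp]: "mstar cj 0 = 0"
  by (simp add: mstar_def vec_eq_iff)

lemma mstar_diff: "mstar cj (a - b) = mstar cj a - mstar cj b"
  by (simp add: mstar_def vec_eq_iff cj_diff)

lemma mstar_minus: "mstar cj (- a) = - mstar cj a"
  by (simp add: mstar_def vec_eq_iff cj_minus)

lemma invertible_mstar [simp]:
  fixes a :: "'K^'n^'n"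
  shows "invertible (mstar cj a) \<longleftrightarrow> invertible a"
  unfolding invertible_def by (metis mstar_mstar mstar_mult mstar_mat)

lemma mstar_block: "mstar cj (block a b c d) = block (mstar cj a) (mstar cj c) (mstar cj b) (mstar cj d)"
  by (auto simp: block_def mstar_def vec_eq_iff split: sum.split)

lemma herm_add_left: "herm cj (x + x') y = herm cj x y + herm cj x' y"
  and herm_add_right: "herm cj x (y + y') = herm cj x y + herm cj x y'"
  and herm_scale_left: "herm cj (a *s x) y = a * herm cj x y"
  and herm_scale_right: "herm cj x (a *s y) = cj a * herm cj x y"
  and herm_minus_left: "herm cj (- x) y = - herm cj x y"
  and herm_minus_right: "herm cj x (- y) = - herm cj x y"
  and herm_zero_left [simp]: "herm cj 0 y = 0"
  and herm_zero_right [simp]: "herm cj x 0 = 0"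
  by (simp_all add: herm_def cj_add cj_mult cj_minus algebra_simps sum.distrib sum_distrib_left sum_negf)

lemma cj_herm: "cj (herm cj x y) = herm cj y x"
  by (simp add: herm_def cj_sum cj_mult mult.commute)

lemma herm_times_matrix: "herm cj (x v* a) y = herm cj x (y v* mstar cj a)"
  unfolding herm_def vector_matrix_mult_def mstar_def
  by (simp add: cj_sum cj_mult sum_distrib_left sum_distrib_right) (subst sum.swap, simp add: mult_ac)

lemma herm_nondegenerate:
  assumes "\<And>y. herm cj x y = 0"
  shows "x = 0"
proof -
  have "x $ i = 0" for i
  proof -
    have "herm cj x (axis i 1) = x $ i"
      by (simp add: herm_def axis_def if_distrib cong: if_cong)
    thus ?thesis using assms by simp
  qed
  thus ?thesis by (simp add: vec_eq_iff)
qed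

subsection \<open>The group as a unitary group\<close>

lemma w_elt_inverse: "w_elt ** (- w_elt) = (mat 1 :: 'K^('n::finite + 'n)^('n + 'n))"
  and w_elt_square: "w_elt ** w_elt = (- mat 1 :: 'K^('n::finite + 'n)^('n + 'n))"
proof -
  show "w_elt ** w_elt = (- mat 1 :: 'K^('n::finite + 'n)^('n + 'n))"
    unfolding w_elt_def block_mult block_one[symmetric]
    by (auto simp: matrix_neg_mult block_def vec_eq_iff split: sum.split)
  thus "w_elt ** (- w_elt) = (mat 1 :: 'K^('n::finite + 'n)^('n + 'n))"
    by (simp add: matrix_neg_mult)
qed

text \<open>The equation \<open>AwA\<^sup>* = w\<close> exhibits \<open>-wA\<^sup>*w\<close> as a right inverse of \<open>A\<close>. It is then also a left
  inverse, which is \<open>A\<^sup>*wA = w\<close>; the two equations comprise the six relations of the group.\<close>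

lemma SL_star_iff:
  fixes A :: "'K^('n::finite + 'n)^('n + 'n)"
  shows "A \<in> carrier (SL_star cj) \<longleftrightarrow> A ** w_elt ** mstar cj A = w_elt"
proof -
  obtain a b c d where A: "A = block a b c d" by (rule block_exhaust)
  let ?s = "mstar cj"
  have 1: "A ** w_elt ** ?s A = w_elt \<longleftrightarrow>
     a ** ?s b = b ** ?s a \<and> c ** ?s d = d ** ?s c \<and>
        a ** ?s d - b ** ?s c = mat 1 \<and> c ** ?s b - d ** ?s a = - mat 1"
    by (auto simp: A w_elt_def mstar_block block_mult block_eq_iff matrix_neg_mult)
  have 2: "?s A ** w_elt ** A = w_elt \<longleftrightarrow>
     ?s a ** c = ?s c ** a \<and> ?s b ** d = ?s d ** b \<and> 
        ?s a ** d - ?s c ** b = mat 1 \<and> ?s b ** c - ?s d ** a = - mat 1"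
    by (auto simp: A w_elt_def mstar_block block_mult block_eq_iff matrix_neg_mult)
  have 3: "c ** ?s b - d ** ?s a = - mat 1" if "a ** ?s d - b ** ?s c = mat 1"
    using arg_cong[OF that, of "\<lambda>x. - ?s x"] by (simp add: mstar_diff mstar_mult)
  have 4: "?s b ** c - ?s d ** a = - mat 1" if "?s a ** d - ?s c ** b = mat 1"
    using arg_cong[OF that, of "\<lambda>x. - ?s x"] by (simp add: mstar_diff mstar_mult)
  have 5: "A \<in> carrier (SL_star cj) \<longleftrightarrow> A ** w_elt ** ?s A = w_elt \<and> ?s A ** w_elt ** A = w_elt"
    unfolding 1 2 using 3 4 by (auto simp: SL_star_def A block_eq_iff)
  have 6: "?s A ** w_elt ** A = w_elt" if h: "A ** w_elt ** ?s A = w_elt"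
  proof -
    have "A ** (w_elt ** ?s A ** (- w_elt)) = mat 1"
      using h w_elt_inverse by (metis matrix_mul_assoc)
    hence "(w_elt ** ?s A ** (- w_elt)) ** A = mat 1"
      by (simp add: matrix_left_right_inverse)
    hence "(- w_elt) ** (w_elt ** ?s A ** (- w_elt) ** A) ** w_elt = - w_elt ** mat 1 ** w_elt"
      by simp
    hence "(- w_elt ** w_elt) ** (?s A ** (- w_elt) ** A ** w_elt) = mat 1"
      by (simp add: matrix_mul_assoc matrix_neg_mult w_elt_square)
    hence "?s A ** (- w_elt) ** A ** w_elt = mat 1"
      by (simp add: matrix_neg_mult w_elt_square)
    hence "?s A ** (- w_elt) ** A ** (w_elt ** - w_elt) = - w_elt"
      by (metis matrix_mul_assoc matrix_mul_lid)
    hence "?s A ** (- w_elt) ** A = - w_elt"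
      by (simp only: w_elt_inverse matrix_mul_rid)
    thus ?thesis by (simp add: matrix_neg_mult)
  qed
  show ?thesis using 5 6 by blast
qed

lemma SL_star_mult:
  fixes A :: "'K^('n::finite + 'n)^('n + 'n)"
  assumes "A \<in> carrier (SL_star cj)" "B \<in> carrier (SL_star cj)"
  shows "A ** B \<in> carrier (SL_star cj)"
  using assms unfolding SL_star_iff mstar_mult by (metis matrix_mul_assoc)

lemma u_elt_in_SL_star:
  assumes "mstar cj s = s"
  shows "u_elt s \<in> carrier (SL_star cj)"
  using assms
  by (simp add: SL_star_iff u_elt_def w_elt_def mstar_block block_mult block_eq_iff matrix_neg_mult)

lemma w_elt_in_SL_star: "w_elt \<in> carrier (SL_star cj)"
  by (simp add: SL_star_iff w_elt_def mstar_block block_mult block_eq_iff matrix_neg_mult mstar_minus)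

lemma h_elt_in_SL_star:
  fixes t :: "'K^'n::finite^'n"
  assumes "invertible t"
  shows "h_elt cj t \<in> carrier (SL_star cj)"
proof -
  have 1: "t ** matrix_inv t = mat 1" using assms by (simp add: matrix_inv_mult)
  have 2: "mstar cj t ** matrix_inv (mstar cj t) = mat 1"
    "matrix_inv (mstar cj t) ** mstar cj t = mat 1"
    using assms by (simp_all add: matrix_inv_mult)
  have "t ** mstar cj (matrix_inv (mstar cj t)) = mat 1"
    using arg_cong[OF 2(2), of "mstar cj"] by (simp add: mstar_mult)
  with 2 show ?thesis
    by (simp add: SL_star_iff h_elt_def w_elt_def mstar_block block_mult block_eq_iff
        matrix_neg_mult mstar_minus)
qed

lemma h_elt_mult:
  fixes s t :: "'K^'n::finite^'n"
  assumes "invertible s" "invertible t"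
  shows "h_elt cj (s ** t) = h_elt cj s ** h_elt cj t"
proof -
  have "mstar cj (s ** t) ** (matrix_inv (mstar cj s) ** matrix_inv (mstar cj t)) = mat 1"
  proof -
    have "mstar cj (s ** t) ** (matrix_inv (mstar cj s) ** matrix_inv (mstar cj t))
        = mstar cj t ** (mstar cj s ** matrix_inv (mstar cj s)) ** matrix_inv (mstar cj t)"
      by (simp add: mstar_mult matrix_mul_assoc)
    thus ?thesis using assms by (simp add: matrix_inv_mult)
  qed
  thus ?thesis
    by (simp add: h_elt_def block_mult matrix_inv_eqI)
qed

text \<open>Here \<open>w\<close> occurs once on the left and twice on the right, so the relation survives the replacement of \<open>w\<close>
  by a nonzero multiple only if the factor is 1.\<close>

lemma w_u_relation:
  "(w_elt :: 'K^('n::finite + 'n)^('n + 'n)) ** u_elt (mat 1)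
     = u_elt (- mat 1) ** w_elt ** u_elt (- mat 1) ** w_elt"
  by (simp add: w_elt_def u_elt_def block_mult block_eq_iff matrix_neg_mult)

subsection \<open>Generators\<close>

text \<open>Take \<open>s = \<Sum> v\<^sup>* v\<close> over a basis of a complement of the row space of \<open>a\<close>. Then \<open>x(a + bs) = 0\<close> splits
  into \<open>xa = 0\<close> and \<open>xb \<bottom> v\<close> for all these \<open>v\<close>, whereas \<open>xa = 0\<close> and \<open>ab\<^sup>* = ba\<^sup>*\<close> make \<open>xb\<close> orthogonal to
  the row space; so \<open>xb = 0\<close>. The row space may meet its orthogonal complement, which is why a
  complement is taken instead.\<close>

lemma exists_hermitian_invertible_combination:
  fixes a b :: "'K^'n::finite^'n"
  assumes ab: "a ** mstar cj b = b ** mstar cj a"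
    and unimodular: "\<And>x. x v* a = 0 \<Longrightarrow> x v* b = 0 \<Longrightarrow> x = 0"
  obtains s where "mstar cj s = s" "invertible (a + b ** s)"
proof -
  define R where "R = range (\<lambda>x. x v* a)"
  have R: "vec.subspace R"
    unfolding R_def vec.subspace_def
    by (auto simp: vector_matrix_left_distrib[symmetric] scalar_vector_matrix_assoc[symmetric]
        intro: range_eqI[of _ _ 0])
  obtain B0 where B0: "B0 \<subseteq> R" "vec.independent B0" "R \<subseteq> vec.span B0"
    by (rule vec.maximal_independent_subset[of R])
  obtain B1 where B1: "B0 \<subseteq> B1" "vec.independent B1" "UNIV \<subseteq> vec.span B1"
    using vec.maximal_independent_subset_extend[OF subset_UNIV B0(2)] by metis
  have fin: "finite B1" using B1(2) by (rule vec.finiteI_independent)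
  define B where "B = B1 - B0"
  define s :: "'K^'n^'n" where "s = (\<chi> i j. \<Sum>v\<in>B. cj (v $ i) * v $ j)"
  have times_s: "x v* s = (\<Sum>v\<in>B. herm cj x v *s v)" for x
    by (simp add: s_def vec_eq_iff vector_matrix_mult_def herm_def sum_distrib_left sum_distrib_right
        mult_ac) (subst sum.swap, simp)
  have herm_s: "mstar cj s = s"
    by (simp add: s_def mstar_def vec_eq_iff cj_sum cj_mult mult.commute)
  have "x = 0" if x: "x v* (a + b ** s) = 0" for x
  proof -
    define y where "y = x v* b"
    have sum0: "x v* a + (\<Sum>v\<in>B. herm cj y v *s v) = 0"
      using x by (simp add: vector_matrix_mult_add_rdistrib vector_matrix_mul_assoc[symmetric]
          times_s y_def)
    have "x v* a \<in> vec.span B0" by (rule subsetD[OF B0(3)]) (simp add: R_def)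
    moreover have "finite B0" by (rule finite_subset[OF B1(1) fin])
    ultimately have "x v* a \<in> range (\<lambda>g. \<Sum>v\<in>B0. g v *s v)"
      by (simp only: vec.span_finite)
    hence "\<exists>g. x v* a = (\<Sum>v\<in>B0. g v *s v)" by (simp only: image_iff bex_UNIV)
    then obtain g where g: "x v* a = (\<Sum>v\<in>B0. g v *s v)" ..
    (* the two summands of x(a + bs) as one linear relation between the vectors of the basis B1 *)
    define f where "f v = (if v \<in> B0 then g v else herm cj y v)" for v
    have "(\<Sum>v\<in>B1. f v *s v) = (\<Sum>v\<in>B0. f v *s v) + (\<Sum>v\<in>B. f v *s v)"
      unfolding B_def by (subst sum.subset_diff[OF B1(1) fin]) (rule add.commute)
    also have "(\<Sum>v\<in>B. f v *s v) = (\<Sum>v\<in>B. herm cj y v *s v)"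
      by (intro sum.cong) (auto simp: f_def B_def)
    also have "(\<Sum>v\<in>B0. f v *s v) + (\<Sum>v\<in>B. herm cj y v *s v) = 0"
      using sum0 g by (simp add: f_def)
    finally have f0: "f v = 0" if "v \<in> B1" for v
      by (rule vec.independentD[OF B1(2) fin subset_refl _ that])
    have xa: "x v* a = 0"
    proof -
      have "g v = 0" if "v \<in> B0" for v
        using f0[of v] that B1(1) by (auto simp: f_def)
      thus ?thesis unfolding g by simp
    qed
    have yB: "herm cj y v = 0" if "v \<in> B" for v
      using f0[of v] that by (auto simp: f_def B_def)
    have "herm cj y v = 0" if "v \<in> R" for v
    proof -
      from that obtain z where z: "v = z v* a" by (auto simp: R_def)
      have "herm cj y v = herm cj (x v* (b ** mstar cj a)) z"
        unfolding y_def z by (metis herm_times_matrix mstar_mstar vector_matrix_mul_assoc)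
      also have "x v* (b ** mstar cj a) = 0"
        by (metis ab xa vector_matrix_mul_assoc vector_matrix_mult_0)
      finally show ?thesis by simp
    qed
    hence yB1: "herm cj y v = 0" if "v \<in> B1" for v
      using that yB B0(1) by (auto simp: B_def)
    have "herm cj y v = 0" for v
    proof -
      have "v \<in> vec.span B1" by (rule subsetD[OF B1(3) UNIV_I])
      thus ?thesis
        by (induction rule: vec.span_induct_alt)
          (simp_all add: herm_add_right herm_scale_right yB1)
    qed
    hence "y = 0" by (rule herm_nondegenerate)
    with xa show ?thesis using unimodular by (simp add: y_def)
  qed
  hence "invertible (transpose (a + b ** s))"
    unfolding invertible_left_inverse matrix_left_invertible_ker by simp
  hence "invertible (a + b ** s)"
    by (metis invertible_def matrix_transpose_mul transpose_mat transpose_transpose)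
  with herm_s show thesis by (rule that)
qed

lemma block_in_SL_star:
  assumes "block a b c d \<in> carrier (SL_star cj)"
  shows "mstar cj a ** c = mstar cj c ** a" "a ** mstar cj b = b ** mstar cj a"
    "a ** mstar cj d - b ** mstar cj c = mat 1" "mstar cj a ** d - mstar cj c ** b = mat 1"
  using assms by (auto simp: SL_star_def block_eq_iff)

text \<open>The factorization with \<open>t = ca\<^sup>-\<^sup>1\<close> and \<open>s = a\<^sup>-\<^sup>1b\<close>. Both are hermitian by the relations between \<open>a\<close>
  and \<open>c\<close> and between \<open>a\<close> and \<open>b\<close>, and the relation between all four blocks determines \<open>d\<close>.\<close>

lemma block_factorization:
  fixes a b c d :: "'K^'n::finite^'n"
  assumes mem: "block a b c d \<in> carrier (SL_star cj)" and a: "invertible a"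
  obtains s t where "mstar cj s = s" "mstar cj t = t"
    "block a b c d = block (mat 1) 0 t (mat 1) ** h_elt cj a ** u_elt s"
proof -
  let ?s = "mstar cj"
  note eqs = block_in_SL_star[OF mem]
  obtain a' where a': "a ** a' = mat 1" "a' ** a = mat 1"
    using a unfolding invertible_def by blast
  have sa': "?s a ** ?s a' = mat 1" "?s a' ** ?s a = mat 1"
    using a' by (simp_all flip: mstar_mult)
  have "?s (c ** a') = ?s a' ** (?s c ** a) ** a'"
    using a' by (simp add: mstar_mult flip: matrix_mul_assoc)
  also have "\<dots> = c ** a'"
    unfolding eqs(1)[symmetric] using sa' by (simp add: matrix_mul_assoc)
  finally have t: "?s (c ** a') = c ** a'" .
  have "?s (a' ** b) = a' ** (a ** ?s b) ** ?s a'"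
    using a' by (simp add: mstar_mult matrix_mul_assoc)
  also have "\<dots> = a' ** b"
    unfolding eqs(2) using sa' by (simp flip: matrix_mul_assoc)
  finally have s: "?s (a' ** b) = a' ** b" .
  have "d = ?s a' ** (?s a ** d)"
    using sa' by (simp add: matrix_mul_assoc)
  also have "?s a ** d = mat 1 + ?s c ** b"
    using eqs(4) by (simp add: algebra_simps)
  also have "?s a' ** (mat 1 + ?s c ** b) = ?s a' + ?s (c ** a') ** b"
    by (simp add: matrix_add_ldistrib mstar_mult matrix_mul_assoc)
  finally have d: "d = ?s a' + c ** a' ** b" unfolding t .
  have inv: "matrix_inv (?s a) = ?s a'"
    using sa'(1) by (rule matrix_inv_eqI)
  have "block a b c d = block (mat 1) 0 (c ** a') (mat 1) ** h_elt cj a ** u_elt (a' ** b)"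
    using a' d
    by (simp add: h_elt_def u_elt_def block_mult block_eq_iff inv matrix_mul_assoc add.commute)
      (simp add: a' flip: matrix_mul_assoc)
  with s t show thesis by (rule that)
qed

text \<open>Lower unipotent elements are conjugates of the \<open>u\<^sub>s\<close> by \<open>w\<close>. Multiplying by one of them from the right
  makes the upper left block invertible. As \<open>P\<close> is closed under products only, the inverse of \<open>w\<close> is
  written as \<open>w\<^sup>3\<close>.\<close>

lemma SL_star_generated [consumes 1, case_names u w h mult]:
  fixes A :: "'K^('n::finite + 'n)^('n + 'n)"
  assumes A: "A \<in> carrier (SL_star cj)"
    and u: "\<And>s. mstar cj s = s \<Longrightarrow> P (u_elt s)"
    and w: "P w_elt"
    and h: "\<And>t. invertible t \<Longrightarrow> P (h_elt cj t)"
    and mult: "\<And>A B. A \<in> carrier (SL_star cj) \<Longrightarrow> B \<in> carrier (SL_star cj) \<Longrightarrow> P A \<Longrightarrow> P B \<Longrightarrow> P (A ** B)"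
  shows "P A"
proof -
  let ?G = "carrier (SL_star cj) :: ('K^('n + 'n)^('n + 'n)) set"
  define l :: "'K^'n^'n \<Rightarrow> 'K^('n + 'n)^('n + 'n)" where "l t = block (mat 1) 0 t (mat 1)" for t
  have l: "l t \<in> ?G \<and> P (l t)" if t: "mstar cj t = t" for t
  proof -
    have "l t = w_elt ** u_elt (- t) ** w_elt ** w_elt ** w_elt"
      by (simp add: l_def w_elt_def u_elt_def block_mult block_eq_iff matrix_neg_mult)
    moreover have "mstar cj (- t) = - t" using t by (simp add: mstar_minus)
    ultimately show ?thesis
      by (simp add: mult u w SL_star_mult w_elt_in_SL_star u_elt_in_SL_star)
  qed
  obtain a b c d where abcd: "A = block a b c d" by (rule block_exhaust)
  note eqs = block_in_SL_star[OF A[unfolded abcd]]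
  have "x = 0" if x: "x v* a = 0" "x v* b = 0" for x
  proof -
    have "x = x v* (a ** mstar cj d - b ** mstar cj c)" by (simp add: eqs(3))
    also have "\<dots> = 0"
      by (simp add: vector_matrix_mult_diff_rdistrib x flip: vector_matrix_mul_assoc)
    finally show ?thesis .
  qed
  then obtain s where s: "mstar cj s = s" "invertible (a + b ** s)"
    using exists_hermitian_invertible_combination[OF eqs(2)] by metis
  define A' where "A' = A ** l s"
  have A': "A' = block (a + b ** s) b (c + d ** s) d"
    by (simp add: A'_def abcd l_def block_mult)
  have A'_mem: "A' \<in> ?G"
    unfolding A'_def using A l[OF s(1)] by (simp add: SL_star_mult)
  have PA': "P A'"
  proof (rule block_factorization[OF A'_mem[unfolded A'] s(2)])
    fix v t assume "mstar cj v = v" "mstar cj t = t"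
      "block (a + b ** s) b (c + d ** s) d
        = block (mat 1) 0 t (mat 1) ** h_elt cj (a + b ** s) ** u_elt v"
    thus "P A'" unfolding A' using l[of t] s(2)
      by (simp add: l_def mult u h SL_star_mult u_elt_in_SL_star h_elt_in_SL_star)
  qed
  have "l s ** l (- s) = mat 1"
    by (simp add: l_def block_mult block_one)
  hence "A = A' ** l (- s)"
    by (simp add: A'_def flip: matrix_mul_assoc)
  moreover have "mstar cj (- s) = - s" using s by (simp add: mstar_minus)
  ultimately show ?thesis using l[of "- s"] A'_mem PA' by (simp add: mult)
qed

end

section \<open>Characters of the general linear group\<close>

definition row_replacement :: "'n \<Rightarrow> 'K^'n \<Rightarrow> 'K::field^'n^'n" where
  "row_replacement j v = (\<chi> i. if i = j then v else axis i 1)"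

lemma matrix_mult_row: "(A ** B) $ i = A $ i v* B"
  by (simp add: matrix_matrix_mult_def vector_matrix_mult_def vec_eq_iff)

lemma times_row_replacement:
  "x v* row_replacement j v = x + x $ j *s (v - axis j 1)"
proof -
  have "(\<Sum>i\<in>UNIV. x $ i * row_replacement j v $ i $ m) = x $ m + x $ j * (v $ m - axis j 1 $ m)" for m
  proof -
    have "(\<Sum>i\<in>UNIV. x $ i * row_replacement j v $ i $ m)
        = (\<Sum>i\<in>UNIV. (if i = m then x $ i else 0) + (if i = j then x $ j * (v $ m - axis j 1 $ m) else 0))"
      by (intro sum.cong) (auto simp: row_replacement_def axis_def algebra_simps)
    thus ?thesis by (simp add: sum.distrib)
  qed
  thus ?thesis by (simp add: vec_eq_iff vector_matrix_mult_def algebra_simps)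
qed

lemma row_replacement_self [simp]: "row_replacement j (axis j 1) = mat 1"
  by (auto simp: row_replacement_def mat_def axis_def vec_eq_iff)

lemma row_replacement_mult:
  "row_replacement j v ** row_replacement j u = row_replacement j (v + v $ j *s (u - axis j 1))"
proof -
  have "(row_replacement j v ** row_replacement j u) $ i
      = row_replacement j (v + v $ j *s (u - axis j 1)) $ i" for i
    unfolding matrix_mult_row times_row_replacement
    by (simp add: row_replacement_def axis_def)
  thus ?thesis by (simp add: vec_eq_iff)
qed

text \<open>The row vector of the inverse of a row replacement.\<close>

definition row_inverse :: "'n \<Rightarrow> 'K^'n \<Rightarrow> 'K::field^'n" where
  "row_inverse j v = axis j 1 + inverse (v $ j) *s (axis j 1 - v)"

lemma row_replacement_inverse:
  assumes "v $ j \<noteq> 0"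
  shows "row_replacement j v ** row_replacement j (row_inverse j v) = mat 1"
    "row_replacement j (row_inverse j v) ** row_replacement j v = mat 1"
proof -
  show "row_replacement j v ** row_replacement j (row_inverse j v) = mat 1"
    using assms
    by (simp add: row_replacement_mult row_inverse_def vector_smult_assoc)
  thus "row_replacement j (row_inverse j v) ** row_replacement j v = mat 1"
    by (simp add: matrix_left_right_inverse)
qed

lemma invertible_row_replacement:
  assumes "v $ j \<noteq> 0"
  shows "invertible (row_replacement j v)"
  using row_replacement_inverse[OF assms] unfolding invertible_def by blast

text \<open>Row replacements turn the rows of \<open>t\<close> into unit vectors one at a time. For row \<open>j\<close> this needs a nonzero
  entry on the diagonal. If it is zero, some entry in a column \<open>l\<close> whose row is not yet a unit vector is
  nonzero, since otherwise row \<open>j\<close> would be a combination of the finished rows; adding column \<open>l\<close> to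
  column \<open>j\<close> leaves the finished rows unchanged and repairs the diagonal entry.\<close>

lemma GL_generated [consumes 1, case_names one row mult]:
  fixes t :: "'K::field^'n::finite^'n"
  assumes t: "invertible t"
    and one: "P (mat 1)"
    and row: "\<And>j v. v $ j \<noteq> 0 \<Longrightarrow> P (row_replacement j v)"
    and mult: "\<And>s t. invertible s \<Longrightarrow> invertible t \<Longrightarrow> P s \<Longrightarrow> P t \<Longrightarrow> P (s ** t)"
  shows "P t"
proof -
  define bad where "bad t = {i. t $ i \<noteq> axis i 1}" for t :: "'K^'n^'n"
  have "\<forall>t. invertible t \<longrightarrow> card (bad t) = N \<longrightarrow> P t" for N
  proof (induction N rule: less_induct)
    case (less N)
    have step: "P t" if t: "invertible t" "card (bad t) \<le> N" "j \<in> bad t" "t $ j $ j \<noteq> 0" for t j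
    proof -
      define t' where "t' = t ** row_replacement j (row_inverse j (t $ j))"
      have "t' ** row_replacement j (t $ j) = t"
        unfolding t'_def matrix_mul_assoc[symmetric] row_replacement_inverse(2)[OF t(4)]
        by (rule matrix_mul_rid)
      note tt' = this[symmetric]
      have nz: "row_inverse j (t $ j) $ j \<noteq> 0"
        using t(4) by (simp add: row_inverse_def)
      have inv: "invertible t'"
        unfolding t'_def using t(1) invertible_row_replacement[OF nz] by (rule invertible_mult)
      have rows: "t' $ i = axis i 1" if "i \<notin> bad t \<or> i = j" for i
      proof (cases "i = j")
        case True
        thus ?thesis using t(4) unfolding t'_def matrix_mult_row times_row_replacement
          by (simp add: row_inverse_def vector_smult_assoc)
      next
        case False
        hence "t $ i = axis i 1" using that by (simp add: bad_def)
        thus ?thesis using False unfolding t'_def matrix_mult_row times_row_replacement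
          by (simp add: axis_def)
      qed
      have "bad t' \<subseteq> bad t" using rows(1) unfolding bad_def by blast
      moreover have "j \<notin> bad t'" using rows[of j] unfolding bad_def by simp
      ultimately have "bad t' \<subset> bad t" using t(3) by blast
      hence "card (bad t') < card (bad t)" by (intro psubset_card_mono) simp_all
      hence "card (bad t') < N" using t(2) by simp
      hence "P t'" by (rule less.IH[rule_format, OF _ inv refl])
      thus ?thesis
        by (subst tt') (intro mult inv invertible_row_replacement row t(4))
    qed
    show ?case
    proof (intro allI impI)
      fix t assume t: "invertible t" "card (bad t) = N"
      show "P t"
      proof (cases "bad t = {}")
        case True
        have "t $ i = mat 1 $ i" for i
        proof -
          have "i \<notin> bad t" unfolding True by simp
          hence "t $ i = axis i 1" by (simp add: bad_def)
          also have "\<dots> = mat 1 $ i" by (simp add: axis_def mat_def eq_commute)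
          finally show ?thesis .
        qed
        hence "t = mat 1" by (simp add: vec_eq_iff[of t])
        with one show ?thesis by simp
      next
        case False
        then obtain j where j: "j \<in> bad t" by blast
        have "\<exists>l\<in>bad t. t $ j $ l \<noteq> 0"
        proof (rule ccontr)
          assume *: "\<not> (\<exists>l\<in>bad t. t $ j $ l \<noteq> 0)"
          (* row j minus its combination of finished rows, as a vector in the left kernel of t *)
          define x :: "'K^'n" where
            "x = (\<chi> i. if i = j then 1 else if i \<in> bad t then 0 else - (t $ j $ i))"
          have "(x v* t) $ m = 0" for m
          proof -
            have "x $ i * t $ i $ m = (if i = j then t $ j $ m else 0)
                - (if i = m then (if m \<in> bad t then 0 else t $ j $ m) else 0)" for i
            proof -
              consider "i = j" | "i \<noteq> j" "i \<in> bad t" | "i \<noteq> j" "i \<notin> bad t" by blast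
              thus ?thesis
              proof cases
                case 3
                hence "t $ i $ m = (if i = m then 1 else 0)"
                  by (simp add: bad_def axis_def)
                thus ?thesis using 3 by (auto simp: x_def)
              qed (use j in \<open>auto simp: x_def\<close>)
            qed
            hence "(x v* t) $ m = (\<Sum>i\<in>UNIV. (if i = j then t $ j $ m else 0)
                - (if i = m then (if m \<in> bad t then 0 else t $ j $ m) else 0))"
              by (simp only: vector_matrix_mult_def vec_lambda_beta)
            also have "\<dots> = t $ j $ m - (if m \<in> bad t then 0 else t $ j $ m)"
              by (simp only: sum_subtractf sum.delta finite UNIV_I if_True)
            also have "\<dots> = 0" using * by auto
            finally show ?thesis .
          qed
          hence "x v* t = 0" by (simp add: vec_eq_iff)
          hence "x v* (t ** matrix_inv t) = 0"
            by (simp only: vector_matrix_mul_assoc[symmetric] vector_matrix_mult_0)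
          hence "x = 0" using t(1) by (simp add: matrix_inv_mult)
          moreover have "x $ j = 1" by (simp add: x_def)
          ultimately show False by simp
        qed
        then obtain l where l: "l \<in> bad t" "t $ j $ l \<noteq> 0" by blast
        show ?thesis
        proof (cases "t $ j $ j = 0")
          case False
          show ?thesis by (rule step[OF t(1) _ j False]) (simp add: t(2))
        next
          case True
          hence lj: "l \<noteq> j" using l by auto
          let ?v = "axis l 1 + axis j 1 :: 'K^'n" and ?u = "axis l 1 - axis j 1 :: 'K^'n"
          define t1 where "t1 = t ** row_replacement l ?v"
          have vl: "?v $ l = 1" "?u $ l = 1" using lj by (auto simp: axis_def)
          hence v: "?v $ l \<noteq> 0" "?u $ l \<noteq> 0" by (simp_all only: one_neq_zero not_False_eq_True)
          have "?v + ?v $ l *s (?u - axis l 1) = axis l 1"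
            unfolding vl(1) by simp
          hence "row_replacement l ?v ** row_replacement l ?u = mat 1"
            by (simp only: row_replacement_mult row_replacement_self)
          hence "t1 ** row_replacement l ?u = t"
            unfolding t1_def matrix_mul_assoc[symmetric] by (simp only: matrix_mul_rid)
          note tt1 = this[symmetric]
          have inv: "invertible t1"
            unfolding t1_def using t(1) invertible_row_replacement[OF v(1)] by (rule invertible_mult)
          have t1j: "t1 $ j $ j \<noteq> 0"
            unfolding t1_def matrix_mult_row times_row_replacement using True l(2) lj
            by (simp add: axis_def)
          have "bad t1 \<subseteq> bad t"
          proof
            fix i assume i: "i \<in> bad t1"
            show "i \<in> bad t"
            proof (rule ccontr)
              assume "i \<notin> bad t"
              hence "t $ i = axis i 1" "i \<noteq> l" using l(1) unfolding bad_def by auto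
              hence "t1 $ i = axis i 1"
                unfolding t1_def matrix_mult_row times_row_replacement by (simp add: axis_def)
              thus False using i by (simp add: bad_def)
            qed
          qed
          hence le: "card (bad t1) \<le> N" using t(2) card_mono[of "bad t" "bad t1"] by simp
          have "P t1"
          proof (cases "j \<in> bad t1")
            case True
            show ?thesis by (rule step[OF inv le True t1j])
          next
            case False
            hence "bad t1 \<subset> bad t" using j \<open>bad t1 \<subseteq> bad t\<close> by blast
            hence "card (bad t1) < N" using t(2) psubset_card_mono[of "bad t" "bad t1"] by simp
            thus ?thesis by (rule less.IH[rule_format, OF _ inv refl])
          qed
          thus ?thesis
            by (subst tt1) (intro mult inv invertible_row_replacement row v(2))
        qed
      qed
    qed
  qed
  thus ?thesis using t by blast
qed

text \<open>A transvection is conjugate to its square under a dilation by 2, so no character sees it.\<close>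

lemma GL_character_eqI:
  fixes f g :: "'K::field^'n::finite^'n \<Rightarrow> complex"
  assumes two: "(2::'K) \<noteq> 0"
    and f_mult: "\<And>s t. invertible s \<Longrightarrow> invertible t \<Longrightarrow> f (s ** t) = f s * f t"
    and g_mult: "\<And>s t. invertible s \<Longrightarrow> invertible t \<Longrightarrow> g (s ** t) = g s * g t"
    and f_nz: "\<And>t. invertible t \<Longrightarrow> f t \<noteq> 0"
    and g_nz: "\<And>t. invertible t \<Longrightarrow> g t \<noteq> 0"
    and dilation: "\<And>j d. d \<noteq> 0 \<Longrightarrow> f (row_replacement j (axis j d)) = g (row_replacement j (axis j d))"
    and t: "invertible t"
  shows "f t = g t"
proof -
  have at_one: "h (mat 1) = 1"
    if "\<And>s t. invertible s \<Longrightarrow> invertible t \<Longrightarrow> h (s ** t) = h s * h t" "\<And>t. invertible t \<Longrightarrow> h t \<noteq> 0"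
    for h :: "'K^'n^'n \<Rightarrow> complex"
  proof -
    have "invertible (mat 1 :: 'K^'n^'n)"
      unfolding invertible_def by (rule exI[of _ "mat 1"]) simp
    thus ?thesis using that(1)[of "mat 1" "mat 1"] that(2)[of "mat 1"] by simp
  qed
  have transvection: "h (row_replacement j v) = 1"
    if h: "\<And>s t. invertible s \<Longrightarrow> invertible t \<Longrightarrow> h (s ** t) = h s * h t" "\<And>t. invertible t \<Longrightarrow> h t \<noteq> 0"
      and v: "v $ j = 1"
    for h :: "'K^'n^'n \<Rightarrow> complex" and j v
  proof -
    let ?D = "row_replacement j (axis j 2) :: 'K^'n^'n" and ?T = "row_replacement j v"
    have "?D ** ?T = ?T ** ?T ** ?D"
      unfolding row_replacement_mult using v
      by (intro arg_cong[of _ _ "row_replacement j"]) (simp add: vec_eq_iff axis_def algebra_simps)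
    hence "h (?D ** ?T) = h (?T ** ?T ** ?D)" by simp
    moreover have inv: "invertible ?D" "invertible ?T"
      using two v by (simp_all add: invertible_row_replacement)
    ultimately have "h ?D * h ?T = h ?T * h ?T * h ?D"
      by (simp only: h(1)[OF inv] h(1)[OF inv(2) inv(2)] h(1)[OF invertible_mult[OF inv(2) inv(2)] inv(1)])
    thus ?thesis using h(2)[OF inv(1)] h(2)[OF inv(2)] by simp
  qed
  show ?thesis using t
  proof (induction rule: GL_generated)
    case one
    have "f (mat 1) = 1" by (rule at_one) (simp_all only: f_mult f_nz not_False_eq_True)
    moreover have "g (mat 1) = 1" by (rule at_one) (simp_all only: g_mult g_nz not_False_eq_True)
    ultimately show ?case by simp
  next
    case (row j v)
    let ?D = "row_replacement j (axis j (v $ j)) :: 'K^'n^'n"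
      and ?T = "row_replacement j (inverse (v $ j) *s v) :: 'K^'n^'n"
    have inv: "invertible ?D" "invertible ?T"
      using row by (simp_all add: invertible_row_replacement)
    have "row_replacement j v = ?D ** ?T"
      unfolding row_replacement_mult using row
      by (intro arg_cong[of _ _ "row_replacement j"]) (auto simp: vec_eq_iff axis_def algebra_simps)
    moreover have "(inverse (v $ j) *s v) $ j = 1" using row by simp
    hence "f ?T = 1" "g ?T = 1"
      using transvection[of f] transvection[of g] f_mult g_mult f_nz g_nz by blast+
    ultimately show ?case
      using f_mult[OF inv] g_mult[OF inv] dilation[OF row] by simp
  next
    case (mult s t)
    thus ?case using f_mult g_mult by simp
  qed
qed

lemma det_dilation: "det (row_replacement j (axis j d) :: 'K::field^'n::finite^'n) = d"
proof -
  have "det (row_replacement j (axis j d) :: 'K^'n^'n)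
      = (\<Prod>i\<in>UNIV. row_replacement j (axis j d) $ i $ i)"
    by (rule det_diagonal) (auto simp: row_replacement_def axis_def)
  also have "\<dots> = (\<Prod>i\<in>UNIV. if i = j then d else 1)"
    by (intro prod.cong) (auto simp: row_replacement_def axis_def)
  finally show ?thesis by simp
qed

section \<open>Quadratic extensions of finite fields\<close>

text \<open>Translation by 1 permutes the field, so it does not change the sum of all elements.\<close>

lemma of_nat_CARD_eq_0: "of_nat CARD('K::{field,finite}) = (0::'K)"
proof -
  have "(\<Sum>x\<in>UNIV. x + 1) = (\<Sum>x\<in>UNIV. x :: 'K)"
    by (rule sum.reindex_bij_witness[of _ "\<lambda>x. x - 1" "\<lambda>x. x + 1"]) auto
  thus ?thesis by (simp add: sum.distrib)
qed

lemma card_le_twice_image: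
  fixes S :: "'K::{field,finite} set"
  assumes "\<And>x y. x \<in> S \<Longrightarrow> y \<in> S \<Longrightarrow> h x = h y \<Longrightarrow> y = x \<or> y = - x"
  shows "card S \<le> 2 * card (h ` S)"
proof -
  have "card S \<le> card (\<Union>z\<in>h ` S. {x \<in> S. h x = z})"
    by (rule card_mono) auto
  also have "\<dots> \<le> (\<Sum>z\<in>h ` S. card {x \<in> S. h x = z})"
    by (rule card_UN_le) simp
  also have "\<dots> \<le> (\<Sum>z\<in>h ` S. 2)"
  proof (rule sum_mono)
    fix z assume "z \<in> h ` S"
    then obtain x where x: "x \<in> S" "z = h x" by (auto elim: imageE)
    have "y \<in> {x, - x}" if "y \<in> {x \<in> S. h x = z}" for y
      using assms[OF x(1), of y] x(2) that by simp
    hence "{x \<in> S. h x = z} \<subseteq> {x, - x}" ..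
    hence "card {x \<in> S. h x = z} \<le> card {x, - x}" by (rule card_mono[rotated]) simp
    also have "\<dots> \<le> 2" by (simp add: card_insert_if)
    finally show "card {x \<in> S. h x = z} \<le> 2" .
  qed
  finally show ?thesis by (simp add: mult.commute)
qed

locale quadratic_extension =
  fixes k :: "'K::{field,finite} set" and cj :: "'K \<Rightarrow> 'K" and q :: nat
  assumes odd_q: "odd q"
    and card_K: "CARD('K) = q\<^sup>2"
    and subfield_k: "is_subfield k"
    and card_k: "card k = q"
    and automorphism_cj: "nontrivial_automorphism_over k cj"
begin

lemma k_zero [simp]: "0 \<in> k"
  and k_one [simp]: "1 \<in> k"
  and k_add: "x \<in> k \<Longrightarrow> y \<in> k \<Longrightarrow> x + y \<in> k"
  and k_diff: "x \<in> k \<Longrightarrow> y \<in> k \<Longrightarrow> x - y \<in> k"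
  and k_mult: "x \<in> k \<Longrightarrow> y \<in> k \<Longrightarrow> x * y \<in> k"
  and k_inverse: "x \<in> k \<Longrightarrow> inverse x \<in> k"
  using subfield_k by (auto simp: is_subfield_def)

lemma k_divide: "x \<in> k \<Longrightarrow> y \<in> k \<Longrightarrow> x / y \<in> k"
  by (simp add: divide_inverse k_mult k_inverse)

lemma k_two [simp]: "2 \<in> k"
  using k_add[of 1 1] by simp

lemma two_neq_0 [simp]: "(2::'K) \<noteq> 0"
proof
  assume 2: "(2::'K) = 0"
  have "odd (q\<^sup>2)" using odd_q by simp
  then obtain m where m: "q\<^sup>2 = 2 * m + 1" by (rule oddE)
  have "0 = of_nat (2 * m + 1) + (0::'K)"
    using of_nat_CARD_eq_0[where 'K = 'K] by (simp only: card_K m add_0_right)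
  also have "\<dots> = 2 * of_nat m + 1" by simp
  also have "\<dots> = 1" by (subst 2) simp
  finally show False by simp
qed

lemma self_neq_minus:
  assumes "(x::'K) \<noteq> 0"
  shows "- x \<noteq> x"
proof
  assume "- x = x"
  hence "x + x = 0" by (simp only: neg_eq_iff_add_eq_0)
  hence "2 * x = 0" by (simp only: mult_2)
  thus False using assms by simp
qed

lemma spanned_by_outside_element:
  assumes "\<theta> \<notin> k"
  obtains a b where "a \<in> k" "b \<in> k" "x = a + b * \<theta>"
proof -
  let ?f = "\<lambda>(a, b). a + b * \<theta>"
  have "inj_on ?f (k \<times> k)"
  proof (rule inj_onI, clarify)
    fix a b a' b' assume in_k: "a \<in> k" "b \<in> k" "a' \<in> k" "b' \<in> k"
      and eq: "a + b * \<theta> = a' + b' * \<theta>"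
    have "b = b'"
    proof (rule ccontr)
      assume "b \<noteq> b'"
      hence "\<theta> = (b - b') * \<theta> / (b - b')" by simp
      also have "(b - b') * \<theta> = a' - a" using eq by (simp add: algebra_simps)
      also have "(a' - a) / (b - b') \<in> k" using in_k by (intro k_divide k_diff)
      finally show False using assms by contradiction
    qed
    thus "a = a' \<and> b = b'" using eq by simp
  qed
  hence "card (?f ` (k \<times> k)) = card (UNIV :: 'K set)"
    by (simp add: card_image card_cartesian_product card_k card_K power2_eq_square)
  hence "?f ` (k \<times> k) = UNIV" by (intro card_subset_eq) simp_all
  hence "x \<in> ?f ` (k \<times> k)" by simp
  thus thesis using that by auto
qed

lemma cj_k: "x \<in> k \<Longrightarrow> cj x = x"
  using automorphism_cj by (simp add: nontrivial_automorphism_over_def)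

text \<open>After completing the square an element outside \<open>k\<close> has its square in \<open>k\<close>, so \<open>cj\<close> can only change its
  sign; and it does, because the element generates \<open>K\<close> over \<open>k\<close>.\<close>

lemma exists_conjugation_generator:
  obtains \<delta> where "\<delta> \<notin> k" "\<delta> * \<delta> \<in> k" "cj \<delta> = - \<delta>"
proof -
  have add: "cj (x + y) = cj x + cj y" and mult: "cj (x * y) = cj x * cj y" for x y
    using automorphism_cj by (simp_all add: nontrivial_automorphism_over_def)
  have "k \<noteq> UNIV"
  proof
    assume "k = UNIV"
    hence "q = q * q" using card_k card_K by (simp only: power2_eq_square)
    hence "q \<le> 1" by auto
    hence "card k \<le> 1" using card_k by simp
    moreover have "card {0, 1 :: 'K} \<le> card k" by (rule card_mono) simp_all
    ultimately show False by simp
  qed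
  then obtain \<theta> where \<theta>: "\<theta> \<notin> k" by blast
  obtain m l where ml: "m \<in> k" "l \<in> k" "\<theta> * \<theta> = m + l * \<theta>"
    by (rule spanned_by_outside_element[OF \<theta>])
  define h where "h = l / 2"
  have h: "h \<in> k" "l = h + h"
    using ml(2) unfolding h_def by (simp_all add: k_divide flip: mult_2)
  define \<delta> where "\<delta> = \<theta> - h"
  have \<delta>_notin: "\<delta> \<notin> k"
  proof
    assume "\<delta> \<in> k"
    hence "\<delta> + h \<in> k" using h by (intro k_add)
    thus False using \<theta> by (simp add: \<delta>_def)
  qed
  have "\<delta> * \<delta> = m + h * h"
    using ml(3) by (simp add: \<delta>_def h(2) algebra_simps)
  hence \<delta>2: "\<delta> * \<delta> \<in> k" using ml(1) h(1) by (simp add: k_add k_mult)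
  have "cj \<delta> * cj \<delta> = \<delta> * \<delta>" using cj_k[OF \<delta>2] by (simp add: mult)
  hence "(cj \<delta> - \<delta>) * (cj \<delta> + \<delta>) = 0" by (simp add: algebra_simps)
  moreover have "cj \<delta> \<noteq> \<delta>"
  proof
    assume eq: "cj \<delta> = \<delta>"
    have "cj x = x" for x
      by (rule spanned_by_outside_element[OF \<delta>_notin, of x]) (simp add: eq add mult cj_k)
    hence "cj = id" by (simp add: fun_eq_iff)
    thus False using automorphism_cj by (simp add: nontrivial_automorphism_over_def)
  qed
  ultimately have "cj \<delta> = - \<delta>" by (simp add: eq_neg_iff_add_eq_0)
  with \<delta>_notin \<delta>2 show thesis by (rule that)
qed

sublocale field_involution cj
proof
  show add: "cj (x + y) = cj x + cj y" and mult: "cj (x * y) = cj x * cj y" for x y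
    using automorphism_cj by (simp_all add: nontrivial_automorphism_over_def)
  obtain \<delta> where \<delta>: "\<delta> \<notin> k" "cj \<delta> = - \<delta>" by (rule exists_conjugation_generator)
  have c: "cj (- \<delta>) = \<delta>"
  proof -
    have "cj \<delta> + cj (- \<delta>) = cj 0" by (simp flip: add)
    thus ?thesis using \<delta>(2) cj_k[OF k_zero] by simp
  qed
  show "cj (cj x) = x" for x
  proof -
    obtain a b where ab: "a \<in> k" "b \<in> k" "x = a + b * \<delta>"
      by (rule spanned_by_outside_element[OF \<delta>(1)])
    have "cj x = a + b * (- \<delta>)"
      by (simp only: ab \<delta>(2) add mult cj_k)
    thus ?thesis by (simp only: add mult c cj_k ab)
  qed
qed

lemma cj_fixed_in_k:
  assumes "cj x = x"
  shows "x \<in> k"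
proof -
  obtain \<delta> where \<delta>: "\<delta> \<notin> k" "cj \<delta> = - \<delta>" by (rule exists_conjugation_generator)
  obtain a b where ab: "a \<in> k" "b \<in> k" "x = a + b * \<delta>"
    by (rule spanned_by_outside_element[OF \<delta>(1)])
  have "a + - (b * \<delta>) = a + b * \<delta>"
    using assms ab \<delta>(2) by (simp add: cj_add cj_mult cj_k)
  hence "- (b * \<delta>) = b * \<delta>" by (rule add_left_imp_eq)
  hence "b * \<delta> = 0" using self_neq_minus[of "b * \<delta>"] by metis
  thus ?thesis using ab(1) by (simp only: ab(3) add_0_right)
qed

lemma trace_in_k: "x + cj x \<in> k"
  by (rule cj_fixed_in_k) (simp add: cj_add add.commute)

text \<open>Writing \<open>\<kappa> = a + b\<delta>\<close> the equation is \<open>a\<^sup>2 + 1 = \<delta>\<^sup>2b\<^sup>2\<close>, and each side takes more than half of the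
  values in \<open>k\<close>.\<close>

lemma exists_norm_minus_one:
  obtains \<kappa> where "\<kappa> * cj \<kappa> = - 1"
proof -
  obtain \<delta> where \<delta>: "\<delta> \<notin> k" "\<delta> * \<delta> \<in> k" "cj \<delta> = - \<delta>" by (rule exists_conjugation_generator)
  have \<delta>0: "\<delta> \<noteq> 0" using \<delta>(1) by auto
  let ?f = "\<lambda>a. a * a + 1" and ?g = "\<lambda>b. (\<delta> * \<delta>) * (b * b)"
  have f: "card k \<le> 2 * card (?f ` k)"
    by (rule card_le_twice_image) (auto simp: square_eq_iff)
  have g: "card k \<le> 2 * card (?g ` k)"
    by (rule card_le_twice_image) (use \<delta>0 in \<open>auto simp: square_eq_iff\<close>)
  have "?f ` k \<inter> ?g ` k \<noteq> {}"
  proof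
    assume "?f ` k \<inter> ?g ` k = {}"
    hence "card (?f ` k) + card (?g ` k) = card (?f ` k \<union> ?g ` k)"
      by (simp add: card_Un_disjoint)
    also have "\<dots> \<le> card k"
      using \<delta>(2) by (intro card_mono) (auto intro!: k_add k_mult)
    finally show False using f g odd_q card_k by presburger
  qed
  then obtain a b where ab: "a \<in> k" "b \<in> k" "a * a + 1 = (\<delta> * \<delta>) * (b * b)" by blast
  have "(a + b * \<delta>) * cj (a + b * \<delta>) = a * a - (\<delta> * \<delta>) * (b * b)"
    using ab(1,2) \<delta>(3) by (simp add: cj_add cj_mult cj_k algebra_simps)
  also have "\<dots> = - 1" by (simp flip: ab(3))
  finally show thesis by (rule that)
qed

lemma exists_nontrivial_square:
  assumes "q > 3"
  obtains r where "r \<in> k" "r \<noteq> 0" "r * r - 1 \<noteq> 0"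
proof -
  have "card {0, 1, - 1 :: 'K} \<le> 3" by (simp add: card_insert_if)
  hence "\<not> k \<subseteq> {0, 1, - 1}"
    using assms card_k card_mono[of "{0, 1, - 1 :: 'K}" k] by fastforce
  then obtain r where "r \<in> k" "r \<noteq> 0" "r \<noteq> 1" "r \<noteq> - 1" by auto
  thus thesis using that[of r] square_eq_1_iff[of r] by simp
qed

end

section \<open>Characters and Gauss sums\<close>

locale quadratic_extension_character = quadratic_extension +
  fixes \<psi> :: "'K::{field,finite} \<Rightarrow> complex"
  assumes additive_\<psi>: "additive_character \<psi>"
    and nontrivial_\<psi>: "\<exists>x. \<psi> x \<noteq> 1"
    and \<psi>_cj_invariant: "\<forall>x. \<psi> x = \<psi> (cj x)"
begin

lemma \<psi>_cj [simp]: "\<psi> (cj x) = \<psi> x"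
  using \<psi>_cj_invariant by simp

lemma \<psi>_0 [simp]: "\<psi> 0 = 1"
  and \<psi>_add: "\<psi> (x + y) = \<psi> x * \<psi> y"
  using additive_\<psi> by (simp_all add: additive_character_def)

lemma \<psi>_minus_mult: "\<psi> (- x) * \<psi> x = 1"
  by (simp flip: \<psi>_add)

lemma \<psi>_neq_0 [simp]: "\<psi> x \<noteq> 0"
  using \<psi>_minus_mult[of x] by auto

lemma \<psi>_sum: "\<psi> (sum f A) = (\<Prod>i\<in>A. \<psi> (f i))"
  by (induction A rule: infinite_finite_induct) (simp_all add: \<psi>_add)

lemma sum_\<psi>_scaled:
  assumes "a \<noteq> 0"
  shows "(\<Sum>x\<in>UNIV. \<psi> (a * x)) = 0"
proof -
  obtain b where b: "\<psi> b \<noteq> 1" using nontrivial_\<psi> by blast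
  have "(\<Sum>x\<in>UNIV. \<psi> (a * x)) = (\<Sum>x\<in>UNIV. \<psi> (b + a * x))"
    by (rule sum.reindex_bij_witness[of _ "\<lambda>x. x + b / a" "\<lambda>x. x - b / a"])
      (use assms in \<open>simp_all add: field_simps\<close>)
  also have "\<dots> = \<psi> b * (\<Sum>x\<in>UNIV. \<psi> (a * x))"
    by (simp add: \<psi>_add sum_distrib_left)
  finally show ?thesis using b by simp
qed

lemma herm_character_nontrivial:
  assumes "x \<noteq> 0"
  obtains y where "\<psi> (herm cj y x) \<noteq> 1"
proof -
  obtain a where a: "\<psi> a \<noteq> 1" using nontrivial_\<psi> by blast
  obtain y where y: "herm cj x y \<noteq> 0" using assms herm_nondegenerate by blast
  hence "herm cj y x \<noteq> 0" by (metis cj_herm cj_eq_0_iff)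
  hence "herm cj ((a / herm cj y x) *s y) x = a" by (simp add: herm_scale_left)
  thus thesis using that a by metis
qed

lemma sum_herm_character:
  fixes x :: "'K^'n::finite"
  assumes "x \<noteq> 0"
  shows "(\<Sum>y\<in>UNIV. \<psi> (herm cj y x)) = 0"
proof -
  obtain y0 where y0: "\<psi> (herm cj y0 x) \<noteq> 1" using herm_character_nontrivial[OF assms] .
  have "(\<Sum>y\<in>UNIV. \<psi> (herm cj y x)) = (\<Sum>y\<in>UNIV. \<psi> (herm cj (y0 + y) x))"
    by (rule sum.reindex_bij_witness[of _ "\<lambda>y. y0 + y" "\<lambda>y. y - y0"]) simp_all
  also have "\<dots> = \<psi> (herm cj y0 x) * (\<Sum>y\<in>UNIV. \<psi> (herm cj y x))"
    by (simp add: herm_add_left \<psi>_add sum_distrib_left)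
  finally show ?thesis using y0 by simp
qed

definition nonzero_squares :: "'K set" where
  "nonzero_squares = (\<lambda>z. z * z) ` (UNIV - {0})"

lemma sum_over_squares:
  fixes f :: "'K \<Rightarrow> complex"
  shows "(\<Sum>z\<in>UNIV. f (z * z)) = f 0 + 2 * (\<Sum>w\<in>nonzero_squares. f w)"
proof -
  have "(\<Sum>z\<in>UNIV - {0}. f (z * z)) = (\<Sum>w\<in>nonzero_squares. \<Sum>z | z \<in> UNIV - {0} \<and> z * z = w. f (z * z))"
    unfolding nonzero_squares_def by (rule sum.image_gen) simp
  also have "\<dots> = (\<Sum>w\<in>nonzero_squares. 2 * f w)"
  proof (rule sum.cong[OF refl])
    fix w assume "w \<in> nonzero_squares"
    then obtain z where z: "z \<noteq> 0" "w = z * z" by (auto simp: nonzero_squares_def)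
    hence "{x. x \<in> UNIV - {0} \<and> x * x = w} = {z, - z}" by (auto simp: square_eq_iff)
    thus "(\<Sum>x | x \<in> UNIV - {0} \<and> x * x = w. f (x * x)) = 2 * f w"
      using z self_neq_minus[of z] by simp
  qed
  finally show ?thesis
    by (simp add: sum.remove[of UNIV 0] sum_distrib_left)
qed

context
  fixes sg :: "'K \<Rightarrow> complex"
  assumes sg: "nontrivial_quadratic_character sg"
begin

lemma sg_mult: "x \<noteq> 0 \<Longrightarrow> y \<noteq> 0 \<Longrightarrow> sg (x * y) = sg x * sg y"
  and sg_square: "x \<noteq> 0 \<Longrightarrow> (sg x)\<^sup>2 = 1"
  using sg by (auto simp: nontrivial_quadratic_character_def)

lemma sg_nonzero_square:
  assumes "w \<in> nonzero_squares"
  shows "sg w = 1"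
proof -
  obtain z where z: "z \<noteq> 0" "w = z * z" using assms by (auto simp: nonzero_squares_def)
  thus ?thesis using sg_square[OF z(1)] sg_mult[OF z(1) z(1)] by (simp add: power2_eq_square)
qed

text \<open>The nonzero squares are half of the nonzero elements, so a single further coset exhausts the rest.\<close>

lemma nonsquares_eq_coset:
  assumes "d \<noteq> 0" "d \<notin> nonzero_squares"
  shows "(*) d ` nonzero_squares \<inter> nonzero_squares = {}"
    and "(*) d ` nonzero_squares \<union> nonzero_squares = UNIV - {0}"
proof -
  show disjoint: "(*) d ` nonzero_squares \<inter> nonzero_squares = {}"
  proof (rule equals0I)
    fix w assume "w \<in> (*) d ` nonzero_squares \<inter> nonzero_squares"
    then obtain y z where "y \<noteq> 0" "z \<noteq> 0" "d * (y * y) = z * z"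
      by (auto simp: nonzero_squares_def)
    hence "d = (z / y) * (z / y)" "z / y \<in> UNIV - {0}" by (simp_all add: field_simps)
    hence "d \<in> nonzero_squares" unfolding nonzero_squares_def by (rule image_eqI)
    thus False using assms(2) by blast
  qed
  have "of_nat CARD('K) = (of_nat (1 + 2 * card nonzero_squares) :: complex)"
    using sum_over_squares[of "\<lambda>_. 1"] by simp
  hence "CARD('K) = 1 + 2 * card nonzero_squares"
    by (simp only: of_nat_eq_iff)
  moreover have "card ((*) d ` nonzero_squares) = card nonzero_squares"
    using assms(1) by (intro card_image inj_onI) simp
  ultimately have "card ((*) d ` nonzero_squares \<union> nonzero_squares) = card (UNIV - {0 :: 'K})"
    using disjoint by (simp add: card_Un_disjoint card_Diff_singleton)
  moreover have "(*) d ` nonzero_squares \<union> nonzero_squares \<subseteq> UNIV - {0}"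
    using assms(1) by (auto simp: nonzero_squares_def)
  ultimately show "(*) d ` nonzero_squares \<union> nonzero_squares = UNIV - {0}"
    by (intro card_subset_eq) simp_all
qed

lemma sg_nonsquare:
  assumes "d \<noteq> 0" "d \<notin> nonzero_squares"
  shows "sg d = - 1"
proof -
  obtain x where x: "x \<noteq> 0" "sg x \<noteq> 1" using sg by (auto simp: nontrivial_quadratic_character_def)
  hence sg_x: "sg x = - 1" using sg_square[of x] by (simp add: power2_eq_1_iff)
  have "x \<notin> nonzero_squares" using x sg_nonzero_square by blast
  hence "d \<in> (*) x ` nonzero_squares"
    using nonsquares_eq_coset(2)[OF x(1)] assms by blast
  then obtain w where w: "w \<in> nonzero_squares" "d = x * w" by blast
  moreover have "w \<noteq> 0" using w assms(1) by auto
  ultimately show ?thesis using sg_mult[OF x(1)] sg_x sg_nonzero_square by simp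
qed

text \<open>If \<open>d\<close> is not a square, the values of \<open>z\<^sup>2\<close> and \<open>dz\<^sup>2\<close> together cover the field twice, so the two
  Gauss sums add up to twice the sum of a nontrivial character.\<close>

lemma gauss_sum_scaled:
  assumes "a \<noteq> 0" "d \<noteq> 0"
  shows "(\<Sum>z\<in>UNIV. \<psi> (a * (d * (z * z)))) = sg d * (\<Sum>z\<in>UNIV. \<psi> (a * (z * z)))"
proof (cases "d \<in> nonzero_squares")
  case True
  then obtain e where e: "e \<noteq> 0" "d = e * e" by (auto simp: nonzero_squares_def)
  have "(\<Sum>z\<in>UNIV. \<psi> (a * (d * (z * z)))) = (\<Sum>z\<in>UNIV. \<psi> (a * (z * z)))"
    by (rule sum.reindex_bij_witness[of _ "\<lambda>z. z / e" "\<lambda>z. e * z"]) (use e in \<open>simp_all add: mult_ac\<close>)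
  thus ?thesis using sg_nonzero_square[OF True] by simp
next
  case False
  note coset = nonsquares_eq_coset[OF assms(2) False]
  have inj: "inj_on ((*) d) nonzero_squares" using assms(2) by (intro inj_onI) simp
  have "(\<Sum>z\<in>UNIV. \<psi> (a * (d * (z * z)))) + (\<Sum>z\<in>UNIV. \<psi> (a * (z * z)))
      = 2 + 2 * ((\<Sum>w\<in>nonzero_squares. \<psi> (a * (d * w))) + (\<Sum>w\<in>nonzero_squares. \<psi> (a * w)))"
    using sum_over_squares[of "\<lambda>w. \<psi> (a * (d * w))"] sum_over_squares[of "\<lambda>w. \<psi> (a * w)"] by simp
  also have "(\<Sum>w\<in>nonzero_squares. \<psi> (a * (d * w))) = (\<Sum>w\<in>(*) d ` nonzero_squares. \<psi> (a * w))"
    by (simp add: sum.reindex[OF inj])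
  also have "(\<Sum>w\<in>(*) d ` nonzero_squares. \<psi> (a * w)) + (\<Sum>w\<in>nonzero_squares. \<psi> (a * w))
      = (\<Sum>w\<in>UNIV - {0}. \<psi> (a * w))"
    unfolding coset(2)[symmetric] using coset(1) by (subst sum.union_disjoint) simp_all
  also have "2 + 2 * (\<Sum>w\<in>UNIV - {0}. \<psi> (a * w)) = 2 * (\<Sum>w\<in>UNIV. \<psi> (a * w))"
    by (simp add: sum.remove[of UNIV 0])
  also have "\<dots> = 0" using sum_\<psi>_scaled[OF assms(1)] by simp
  finally show ?thesis
    unfolding sg_nonsquare[OF assms(2) False] by (simp add: eq_neg_iff_add_eq_0)
qed

lemma sum_vec_prod:
  fixes f :: "'n::finite \<Rightarrow> 'K \<Rightarrow> complex"
  shows "(\<Sum>x\<in>UNIV. \<Prod>i\<in>UNIV. f i (x $ i)) = (\<Prod>i\<in>UNIV. \<Sum>z\<in>UNIV. f i z)"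
proof -
  have "(\<Prod>i\<in>UNIV. \<Sum>z\<in>UNIV. f i z) = (\<Sum>g\<in>UNIV. \<Prod>i\<in>UNIV. f i (g i))"
    by (subst prod_sum_PiE) (simp_all add: PiE_UNIV_domain)
  also have "\<dots> = (\<Sum>x\<in>UNIV. \<Prod>i\<in>UNIV. f i (x $ i))"
    by (rule sum.reindex_bij_witness[of _ "vec_nth" "vec_lambda"]) (simp_all add: fun_eq_iff)
  finally show ?thesis by simp
qed

lemma gauss_sum_diagonal:
  fixes d :: "'K^'n::finite"
  assumes "\<And>i. d $ i \<noteq> 0"
  shows "(\<Sum>x\<in>UNIV. \<psi> (inverse 2 * (\<Sum>i\<in>UNIV. d $ i * (x $ i * x $ i))))
    = (\<Prod>i\<in>UNIV. sg (d $ i)) * (\<Sum>z\<in>UNIV. \<psi> (inverse 2 * (z * z))) ^ CARD('n)"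
proof -
  have "(\<Sum>x\<in>UNIV. \<psi> (inverse 2 * (\<Sum>i\<in>UNIV. d $ i * (x $ i * x $ i))))
      = (\<Sum>x\<in>UNIV. \<Prod>i\<in>UNIV. \<psi> (inverse 2 * (d $ i * (x $ i * x $ i))))"
    by (simp add: sum_distrib_left \<psi>_sum)
  also have "\<dots> = (\<Prod>i\<in>UNIV. \<Sum>z\<in>UNIV. \<psi> (inverse 2 * (d $ i * (z * z))))"
    by (rule sum_vec_prod)
  also have "\<dots> = (\<Prod>i\<in>UNIV. sg (d $ i) * (\<Sum>z\<in>UNIV. \<psi> (inverse 2 * (z * z))))"
    using assms by (intro prod.cong[OF refl] gauss_sum_scaled) simp_all
  finally show ?thesis by (simp add: prod.distrib)
qed

end
end

section \<open>The Heisenberg representation\<close>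

lemma linear_scale_simps:
  assumes "Vector_Spaces.linear s s' f"
  shows "f (u + v) = f u + f v" "f (s a v) = s' a (f v)" "f (sum g A) = (\<Sum>i\<in>A. f (g i))" "f 0 = 0"
  using assms module_hom.add module_hom.scale module_hom.sum module_hom.zero
  unfolding linear_iff_module_hom by metis+

locale Weil_setting = quadratic_extension_character k cj q \<psi>
  for k :: "'K::{field,finite} set" and cj q \<psi> +
  fixes \<phi> :: "'K \<Rightarrow> complex"
    and scale :: "complex \<Rightarrow> 'v::ab_group_add \<Rightarrow> 'v"
    and \<eta> :: "('K^('n::finite + 'n)) \<times> 'K \<Rightarrow> 'v \<Rightarrow> 'v"
    and W :: "('K^('n + 'n) \<Rightarrow> 'K^('n + 'n)) \<Rightarrow> 'v \<Rightarrow> 'v"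
  assumes q_gt_3: "q > 3"
    and \<phi>_\<psi>: "\<forall>x. \<phi> (- 2 * x) = \<psi> x"
    and Weil: "Weil_representation k cj \<phi> scale \<eta> W"
begin

lemma \<phi>_eq: "\<phi> x = \<psi> (- (inverse 2 * x))"
  using \<phi>_\<psi>[rule_format, of "- (inverse 2 * x)"] by (simp add: mult.assoc[symmetric])

lemma half_add_half: "inverse 2 * x + inverse 2 * x = (x :: 'K)"
proof -
  have "inverse 2 * x + inverse 2 * x = (inverse 2 * 2) * x"
    by (simp only: mult_2_right distrib_right)
  thus ?thesis by simp
qed

text \<open>The cocycle of the Heisenberg group is half of a trace. On it \<open>\<phi>\<close> becomes a value of \<open>\<psi>\<close>, because \<open>\<psi>\<close>
  is invariant under conjugation.\<close>

lemma \<phi>_half_trace: "\<phi> ((x + cj x) / 2) = \<psi> (- (inverse 2 * x))"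
proof -
  let ?u = "- (inverse 2 * (inverse 2 * x))"
  have "cj ?u = - (inverse 2 * (inverse 2 * cj x))"
    by (simp only: cj_minus cj_mult cj_inverse cj_numeral)
  moreover have "(x + cj x) / 2 = inverse 2 * (x + cj x)"
    by (simp only: divide_inverse mult.commute)
  ultimately have "\<phi> ((x + cj x) / 2) = \<psi> (?u + cj ?u)"
    by (simp only: \<phi>_eq distrib_left minus_add_distrib)
  also have "\<dots> = \<psi> (?u + ?u)"
    by (simp only: \<psi>_add \<psi>_cj)
  also have "?u + ?u = - (inverse 2 * x)"
    by (simp only: minus_add_distrib[symmetric] half_add_half)
  finally show ?thesis .
qed

lemma irreducible_\<eta>: "irreducible_representation (Heisenberg k cj) scale \<eta>"
  and \<eta>_central: "t \<in> k \<Longrightarrow> \<eta> (0, t) = scale (\<phi> t)"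
  and representation_W: "representation (Sp k cj) scale W"
  and W_conj: "g \<in> carrier (Sp k cj) \<Longrightarrow> t \<in> k \<Longrightarrow>
      W g \<circ> \<eta> (z, t) \<circ> Hilbert_Choice.inv (W g) = \<eta> (Hilbert_Choice.inv g z, t)"
  using Weil by (simp_all add: Weil_representation_def)

lemma representation_\<eta>: "representation (Heisenberg k cj) scale \<eta>"
  using irreducible_\<eta> by (simp add: irreducible_representation_def)

lemma vector_space_scale: "vector_space scale"
  using representation_\<eta> by (simp add: representation_def)

sublocale V: vector_space scale
  by (rule vector_space_scale)

lemma \<eta>_linear: "t \<in> k \<Longrightarrow> Vector_Spaces.linear scale scale (\<eta> (z, t))"
  using representation_\<eta> by (simp add: representation_def Heisenberg_def)

lemma \<eta>_id: "\<eta> (0, 0) v = v"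
  using representation_\<eta> by (simp add: representation_def Heisenberg_def)

lemma \<eta>_mult:
  assumes "s \<in> k" "t \<in> k"
  shows "\<eta> (z, s) (\<eta> (z', t) v) = \<eta> (z + z', s + t + symplectic_form cj z z' / 2) v"
proof -
  have "\<eta> ((z, s) \<otimes>\<^bsub>Heisenberg k cj\<^esub> (z', t)) = \<eta> (z, s) \<circ> \<eta> (z', t)"
    using representation_\<eta> assms unfolding representation_def by (simp add: Heisenberg_def)
  thus ?thesis by (simp add: Heisenberg_def fun_eq_iff)
qed

lemma symplectic_form_hpair:
  fixes x y x' y' :: "'K^'n"
  shows "symplectic_form cj (hpair x y) (hpair x' y')
    = (herm cj x y' + cj (herm cj x y')) - (herm cj y x' + cj (herm cj y x'))"
proof -
  have skew: "skew_hermitian_form cj (hpair x y) (hpair x' y') = herm cj x y' - herm cj y x'"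
    for x y x' y' :: "'K^'n"
    unfolding skew_hermitian_form_def hpair_times_block sum_UNIV_Plus
    by (simp add: hpair_def herm_def vector_matrix_neg sum_negf)
  show ?thesis
    by (simp add: symplectic_form_def skew cj_herm)
qed

lemma \<eta>_scalar:
  assumes "t \<in> k"
  shows "\<eta> (z, t) v = scale (\<phi> t) (\<eta> (z, 0) v)"
proof -
  have "symplectic_form cj 0 z = 0"
  proof -
    obtain x y :: "'K^'n" where "z = hpair x y" by (rule hpair_exhaust)
    thus ?thesis using symplectic_form_hpair[of 0 0 x y] by simp
  qed
  hence "\<eta> (0, t) (\<eta> (z, 0) v) = \<eta> (z, t) v"
    using \<eta>_mult[OF assms k_zero, of 0 z v] by simp
  thus ?thesis using \<eta>_central[OF assms] by simp
qed

definition X :: "'K^'n \<Rightarrow> 'v \<Rightarrow> 'v" where "X x = \<eta> (hpair x 0, 0)"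
definition Y :: "'K^'n \<Rightarrow> 'v \<Rightarrow> 'v" where "Y y = \<eta> (hpair 0 y, 0)"

lemma X_linear: "Vector_Spaces.linear scale scale (X x)"
  and Y_linear: "Vector_Spaces.linear scale scale (Y y)"
  by (simp_all add: X_def Y_def \<eta>_linear)

lemmas X_simps = linear_scale_simps[OF X_linear]
lemmas Y_simps = linear_scale_simps[OF Y_linear]

lemma X_0 [simp]: "X 0 v = v" and Y_0 [simp]: "Y 0 v = v"
  by (simp_all add: X_def Y_def \<eta>_id)

lemma X_X: "X x (X x' v) = X (x + x') v"
  by (simp add: X_def \<eta>_mult symplectic_form_hpair)

lemma Y_Y: "Y y (Y y' v) = Y (y + y') v"
  by (simp add: Y_def \<eta>_mult symplectic_form_hpair)

lemma \<eta>_hpair: "\<eta> (hpair x y, 0) v = scale (\<psi> (inverse 2 * herm cj x y)) (X x (Y y v))"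
proof -
  let ?t = "(herm cj x y + cj (herm cj x y)) / 2"
  have "?t \<in> k" by (intro k_divide trace_in_k k_two)
  moreover have "X x (Y y v) = \<eta> (hpair x y, ?t) v"
    by (simp add: X_def Y_def \<eta>_mult symplectic_form_hpair)
  ultimately have "X x (Y y v) = scale (\<psi> (- (inverse 2 * herm cj x y))) (\<eta> (hpair x y, 0) v)"
    by (simp only: \<eta>_scalar[of ?t] \<phi>_half_trace)
  thus ?thesis by (simp flip: \<psi>_add)
qed

lemma Y_X: "Y y (X x v) = scale (\<psi> (herm cj x y)) (X x (Y y v))"
proof -
  let ?t = "(- herm cj x y + cj (- herm cj x y)) / 2"
  have "?t \<in> k" by (intro k_divide trace_in_k k_two)
  moreover have "- (herm cj y x + cj (herm cj y x)) = - herm cj x y + cj (- herm cj x y)"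
    by (simp add: cj_minus cj_herm)
  hence "Y y (X x v) = \<eta> (hpair x y, ?t) v"
    by (simp add: X_def Y_def \<eta>_mult symplectic_form_hpair)
  ultimately have "Y y (X x v) = scale (\<psi> (inverse 2 * herm cj x y)) (\<eta> (hpair x y, 0) v)"
    by (simp only: \<eta>_scalar[of ?t] \<phi>_half_trace) simp
  thus ?thesis
    by (simp only: \<eta>_hpair V.scale_scale \<psi>_add[symmetric] half_add_half)
qed

lemma X_cancel: "X (- x) (X x v) = v"
  by (simp add: X_X)

text \<open>Averaging over the second Lagrangian, after a shift by \<open>x\<close>, projects onto one of its characters;
  summing these projections over \<open>x\<close> recovers a multiple of the vector, so one of them is nonzero.\<close>

lemma exists_Y_invariant: "\<exists>v. v \<noteq> 0 \<and> (\<forall>y. Y y v = v)"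
proof -
  obtain v :: 'v where v: "v \<noteq> 0"
    using irreducible_\<eta> by (auto simp: irreducible_representation_def)
  define p where "p x = (\<Sum>y\<in>UNIV. Y y (X x v))" for x
  have inv: "Y y0 (p x) = p x" for y0 x
  proof -
    have "Y y0 (p x) = (\<Sum>y\<in>UNIV. Y (y0 + y) (X x v))"
      by (simp only: p_def Y_simps Y_Y)
    also have "\<dots> = p x"
      unfolding p_def
      by (rule sum.reindex_bij_witness[of _ "\<lambda>y. y - y0" "\<lambda>y. y0 + y"]) simp_all
    finally show ?thesis .
  qed
  have "\<exists>x. p x \<noteq> 0"
  proof (rule ccontr)
    assume "\<not> (\<exists>x. p x \<noteq> 0)"
    hence "0 = (\<Sum>x\<in>UNIV. X (- x) (p x))"
      by (simp add: X_simps)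
    also have "\<dots> = (\<Sum>x\<in>UNIV. \<Sum>y\<in>UNIV. scale (\<psi> (herm cj x y)) (Y y v))"
      unfolding p_def X_simps(3) by (simp add: Y_X X_simps X_cancel)
    also have "\<dots> = (\<Sum>y\<in>UNIV. scale (\<Sum>x\<in>UNIV. \<psi> (herm cj x y)) (Y y v))"
      by (subst sum.swap) (simp add: V.scale_sum_left)
    also have "\<dots> = (\<Sum>y\<in>UNIV. if y = (0::'K^'n) then scale (of_nat CARD('K^'n)) v else 0)"
      by (intro sum.cong) (auto simp: sum_herm_character)
    also have "\<dots> = scale (of_nat CARD('K^'n)) v" by simp
    finally show False using v by (simp del: CARD_vec)
  qed
  then obtain x where "p x \<noteq> 0" ..
  with inv show ?thesis by blast
qed

definition v0 :: 'v where "v0 = (SOME v. v \<noteq> 0 \<and> (\<forall>y. Y y v = v))"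

lemma v0_neq_0: "v0 \<noteq> 0" and Y_v0 [simp]: "Y y v0 = v0"
  using someI_ex[OF exists_Y_invariant] by (auto simp: v0_def)

definition b :: "'K^'n \<Rightarrow> 'v" where "b x = X x v0"

lemma b_0 [simp]: "b 0 = v0" by (simp add: b_def)

lemma b_neq_0: "b x \<noteq> 0"
proof
  assume "b x = 0"
  hence "X (- x) (X x v0) = 0" by (simp only: b_def X_simps)
  thus False using v0_neq_0 by (simp add: X_cancel)
qed

lemma X_b: "X x (b y) = b (x + y)"
  by (simp add: b_def X_X)

lemma Y_b: "Y y (b x) = scale (\<psi> (herm cj x y)) (b x)"
  by (simp add: b_def Y_X)

definition comb :: "('K^'n \<Rightarrow> complex) \<Rightarrow> 'v" where
  "comb f = (\<Sum>x\<in>UNIV. scale (f x) (b x))"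

lemma X_comb: "X x (comb f) = comb (\<lambda>z. f (z - x))"
  unfolding comb_def X_simps X_b
  by (rule sum.reindex_bij_witness[of _ "\<lambda>z. z - x" "\<lambda>z. x + z"]) simp_all

lemma Y_comb: "Y y (comb f) = comb (\<lambda>z. f z * \<psi> (herm cj z y))"
  unfolding comb_def Y_simps Y_b by simp

lemma comb_scale: "scale a (comb f) = comb (\<lambda>x. a * f x)"
  by (simp add: comb_def V.scale_sum_right)

lemma comb_add: "comb f + comb g = comb (\<lambda>x. f x + g x)"
  by (simp add: comb_def V.scale_left_distrib sum.distrib)

lemma comb_single: "comb (\<lambda>x. if x = a then c else 0) = scale c (b a)"
proof -
  have "comb (\<lambda>x. if x = a then c else 0) = (\<Sum>x\<in>UNIV. if x = a then scale c (b x) else 0)"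
    unfolding comb_def by (intro sum.cong) auto
  thus ?thesis by simp
qed

lemma comb_surj: "\<exists>f. v = comb f"
proof -
  have sub: "V.subspace (range comb)"
    unfolding V.subspace_def
  proof (intro conjI allI ballI)
    show "0 \<in> range comb" by (rule range_eqI[of _ _ "\<lambda>_. 0"]) (simp add: comb_def)
  qed (auto simp: comb_scale comb_add)
  have inv: "\<eta> g ` range comb \<subseteq> range comb" if "g \<in> carrier (Heisenberg k cj)" for g
  proof -
    obtain z t where g: "g = (z, t)" "t \<in> k" using \<open>g \<in> _\<close> by (auto simp: Heisenberg_def)
    obtain x y :: "'K^'n" where z: "z = hpair x y" by (rule hpair_exhaust)
    have "\<eta> g (comb f) \<in> range comb" for f
      unfolding g(1) z \<eta>_scalar[OF g(2)] \<eta>_hpair Y_comb X_comb comb_scale by simp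
    thus ?thesis by auto
  qed
  have "range comb = {0} \<or> range comb = UNIV"
    using irreducible_\<eta> sub inv unfolding irreducible_representation_def by blast
  moreover have "b 0 \<in> range comb"
    using comb_single[of 0 1] by (metis V.scale_one rangeI)
  ultimately have "range comb = UNIV" using b_neq_0[of 0] by auto
  thus ?thesis by auto
qed

text \<open>Projecting onto the character by which the second Lagrangian acts on \<open>b a\<close> isolates the coefficient
  at \<open>a\<close>.\<close>

lemma comb_eq_0D:
  assumes "comb f = 0"
  shows "f a = 0"
proof -
  have "0 = (\<Sum>y\<in>UNIV. scale (\<psi> (- herm cj a y)) (Y y (comb f)))"
    by (simp add: assms Y_simps)
  also have "\<dots> = comb (\<lambda>x. f x * (\<Sum>y\<in>UNIV. \<psi> (herm cj y (x - a))))"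
  proof -
    have e: "\<psi> (- herm cj a y) * (f x * \<psi> (herm cj x y)) = f x * \<psi> (herm cj y (x - a))" for x y
    proof -
      have "\<psi> (herm cj y (x - a)) = \<psi> (herm cj (x - a) y)"
        by (metis \<psi>_cj cj_herm)
      also have "\<dots> = \<psi> (herm cj x y) * \<psi> (- herm cj a y)"
        by (simp add: herm_add_left[of x "- a", simplified] herm_minus_left flip: \<psi>_add)
      finally show ?thesis by simp
    qed
    show ?thesis
      unfolding Y_comb comb_scale e
      unfolding comb_def by (subst sum.swap) (simp add: sum_distrib_left V.scale_sum_left)
  qed
  also have "\<dots> = comb (\<lambda>x. if x = a then f a * of_nat CARD('K^'n) else 0)"
    by (intro arg_cong[of _ _ comb] ext) (simp add: sum_herm_character)
  also have "\<dots> = scale (f a * of_nat CARD('K^'n)) (b a)" by (rule comb_single)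
  finally show ?thesis using b_neq_0[of a] by (simp del: CARD_vec)
qed

lemma comb_eqD:
  assumes "comb f = comb g"
  shows "f a = g a"
proof -
  have "comb f + scale (- 1) (comb g) = 0" using assms by simp
  hence "comb (\<lambda>x. f x + - 1 * g x) = 0" by (simp only: comb_scale comb_add)
  from comb_eq_0D[OF this, of a] show ?thesis by simp
qed

lemma Y_invariant:
  assumes "\<And>y. Y y v = v"
  shows "\<exists>c. v = scale c v0"
proof -
  obtain f where f: "v = comb f" using comb_surj by blast
  have f0: "f x = 0" if "x \<noteq> 0" for x
  proof -
    obtain y where "\<psi> (herm cj y x) \<noteq> 1" using herm_character_nontrivial[OF \<open>x \<noteq> 0\<close>] .
    hence y: "\<psi> (herm cj x y) \<noteq> 1" by (metis \<psi>_cj cj_herm)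
    have "comb (\<lambda>z. f z * \<psi> (herm cj z y)) = comb f"
      using assms[of y] unfolding f Y_comb .
    from comb_eqD[OF this, of x] show ?thesis using y by simp
  qed
  have "f = (\<lambda>x. if x = 0 then f 0 else 0)" using f0 by auto
  hence "v = scale (f 0) (b 0)" using comb_single[of 0 "f 0"] f by simp
  thus ?thesis by auto
qed

lemma X_invariant:
  assumes "\<And>x. X x v = v"
  shows "\<exists>c. v = comb (\<lambda>_. c)"
proof -
  obtain f where f: "v = comb f" using comb_surj by blast
  have "f z = f 0" for z
  proof -
    have "comb (\<lambda>u. f (u - z)) = comb f" using assms[of z] unfolding f X_comb .
    from comb_eqD[OF this, of z] show ?thesis by simp
  qed
  hence "f = (\<lambda>_. f 0)" by (rule ext)
  thus ?thesis using f by metis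
qed

end

section \<open>The Weil operators of elementary symplectic maps\<close>

definition left_part :: "'K^('n::finite + 'n) \<Rightarrow> 'K^'n" where "left_part z = (\<chi> i. z $ Inl i)"
definition right_part :: "'K^('n::finite + 'n) \<Rightarrow> 'K^'n" where "right_part z = (\<chi> i. z $ Inr i)"

lemma left_part_hpair [simp]: "left_part (hpair x y) = x"
  and right_part_hpair [simp]: "right_part (hpair x y) = y"
  by (simp_all add: left_part_def right_part_def hpair_def vec_eq_iff)

definition shear :: "('K::field^'n \<Rightarrow> 'K^'n) \<Rightarrow> 'K^('n::finite + 'n) \<Rightarrow> 'K^('n + 'n)" where
  "shear f z = hpair (left_part z) (right_part z + f (left_part z))"

definition exchange :: "'K::field^('n::finite + 'n) \<Rightarrow> 'K^('n + 'n)" where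
  "exchange z = hpair (- right_part z) (left_part z)"

definition hscale :: "('K::field^'n \<Rightarrow> 'K^'n) \<Rightarrow> ('K^'n \<Rightarrow> 'K^'n) \<Rightarrow> 'K^('n::finite + 'n) \<Rightarrow> 'K^('n + 'n)" where
  "hscale T T' z = hpair (T (left_part z)) (T' (right_part z))"

lemma shear_hpair [simp]: "shear f (hpair x y) = hpair x (y + f x)"
  and exchange_hpair [simp]: "exchange (hpair x y) = hpair (- y) x"
  and hscale_hpair [simp]: "hscale T T' (hpair x y) = hpair (T x) (T' y)"
  by (simp_all add: shear_def exchange_def hscale_def)

context quadratic_extension
begin

definition k_linear :: "('K^'n \<Rightarrow> 'K^'n) \<Rightarrow> bool" where
  "k_linear f \<longleftrightarrow> (\<forall>x y. f (x + y) = f x + f y) \<and> (\<forall>c\<in>k. \<forall>x. f (c *s x) = c *s f x)"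

definition trace_form :: "'K^'n \<Rightarrow> 'K^'n \<Rightarrow> 'K" where
  "trace_form x y = herm cj x y + cj (herm cj x y)"

text \<open>Right multiplication by a hermitian matrix is such a map, but so are suitable conjugate-linear maps;
  both give shears in the symplectic group.\<close>

definition k_symmetric :: "('K^'n \<Rightarrow> 'K^'n) \<Rightarrow> bool" where
  "k_symmetric f \<longleftrightarrow> k_linear f \<and> (\<forall>x y. trace_form x (f y) = trace_form (f x) y)"

lemma trace_form_add: "trace_form (x + x') y = trace_form x y + trace_form x' y"
    "trace_form x (y + y') = trace_form x y + trace_form x y'"
  and trace_form_minus: "trace_form (- x) y = - trace_form x y" "trace_form x (- y) = - trace_form x y"
  and trace_form_commute: "trace_form x y = trace_form y x"
  by (simp_all add: trace_form_def herm_add_left herm_add_right herm_minus_left herm_minus_right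
      cj_add cj_minus cj_herm)

lemma trace_form_scale:
  assumes "c \<in> k"
  shows "trace_form (c *s x) y = c * trace_form x y" "trace_form x (c *s y) = c * trace_form x y"
  by (simp_all add: trace_form_def herm_scale_left herm_scale_right cj_mult cj_k[OF assms] distrib_left)

lemma Sp_I:
  fixes g :: "'K^('n::finite + 'n) \<Rightarrow> 'K^('n + 'n)"
  assumes add: "\<And>x y x' y'. g (hpair (x + x') (y + y')) = g (hpair x y) + g (hpair x' y')"
    and scale: "\<And>c x y. c \<in> k \<Longrightarrow> g (hpair (c *s x) (c *s y)) = c *s g (hpair x y)"
    and form: "\<And>x y x' y'. symplectic_form cj (g (hpair x y)) (g (hpair x' y'))
      = symplectic_form cj (hpair x y) (hpair x' y')"
    and left_inverse: "\<And>x y. h (g (hpair x y)) = hpair x y"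
  shows "g \<in> carrier (Sp k cj)"
proof -
  have "h (g z) = z" for z
  proof -
    obtain x y where "z = hpair x y" by (rule hpair_exhaust)
    thus ?thesis using left_inverse by simp
  qed
  hence "inj g" by (rule inj_on_inverseI)
  hence "bij g" by (simp add: bij_def finite_UNIV_inj_surj)
  moreover have "g (z + z') = g z + g z'" for z z'
  proof -
    obtain x y x' y' where "z = hpair x y" "z' = hpair x' y'" using hpair_exhaust by metis
    thus ?thesis using add by simp
  qed
  moreover have "g (c *s z) = c *s g z" if "c \<in> k" for c z
  proof -
    obtain x y where "z = hpair x y" by (rule hpair_exhaust)
    thus ?thesis using scale[OF that] by simp
  qed
  moreover have "symplectic_form cj (g z) (g z') = symplectic_form cj z z'" for z z'
  proof -
    obtain x y x' y' where "z = hpair x y" "z' = hpair x' y'" using hpair_exhaust by metis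
    thus ?thesis using form by simp
  qed
  ultimately show ?thesis by (simp add: Sp_def)
qed

end

context Weil_setting
begin

lemma symplectic_form_trace:
  "symplectic_form cj (hpair x y) (hpair x' y') = trace_form x y' - trace_form y (x' :: 'K^'n)"
  by (simp add: symplectic_form_hpair trace_form_def)

lemma shear_in_Sp:
  fixes f :: "'K^'n \<Rightarrow> 'K^'n"
  assumes "k_symmetric f"
  shows "shear f \<in> carrier (Sp k cj)"
proof (rule Sp_I[where h = "shear (\<lambda>x. - f x)"])
  fix x y x' y' :: "'K^'n"
  show "symplectic_form cj (shear f (hpair x y)) (shear f (hpair x' y'))
      = symplectic_form cj (hpair x y) (hpair x' y')"
    using assms by (simp add: symplectic_form_trace k_symmetric_def trace_form_add)
qed (use assms in \<open>auto simp: k_symmetric_def k_linear_def add_ac vector_add_ldistrib\<close>)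

lemma exchange_in_Sp: "exchange \<in> carrier (Sp k cj :: (_ \<Rightarrow> 'K^('n + 'n)) monoid)"
proof (rule Sp_I[where h = "exchange \<circ> exchange \<circ> exchange"])
  fix x y x' y' :: "'K^'n"
  show "symplectic_form cj (exchange (hpair x y)) (exchange (hpair x' y'))
      = symplectic_form cj (hpair x y) (hpair x' y')"
    by (simp add: symplectic_form_trace trace_form_minus trace_form_commute[of y])
qed (simp_all add: vector_smult_rneg)

lemma hscale_in_Sp:
  fixes T T' :: "'K^'n \<Rightarrow> 'K^'n"
  assumes "k_linear T" "k_linear T'" "\<And>x. U (T x) = x" "\<And>y. U' (T' y) = y"
    and "\<And>x y. trace_form (T x) (T' y) = trace_form x y"
  shows "hscale T T' \<in> carrier (Sp k cj)"
proof (rule Sp_I[where h = "hscale U U'"])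
  fix x y x' y' :: "'K^'n"
  show "symplectic_form cj (hscale T T' (hpair x y)) (hscale T T' (hpair x' y'))
      = symplectic_form cj (hpair x y) (hpair x' y')"
    by (simp add: symplectic_form_trace assms(5) trace_form_commute[of "T' _"] trace_form_commute[of y])
qed (use assms in \<open>simp_all add: k_linear_def\<close>)

lemma Sp_compose:
  fixes g h :: "'K^('n + 'n) \<Rightarrow> 'K^('n + 'n)"
  assumes "g \<in> carrier (Sp k cj)" "h \<in> carrier (Sp k cj)"
  shows "g \<circ> h \<in> carrier (Sp k cj)"
  using assms by (auto simp: Sp_def intro: bij_comp)

lemma Sp_bij: "g \<in> carrier (Sp k cj) \<Longrightarrow> bij g"
  by (simp add: Sp_def)

lemma Sp_inv:
  fixes g :: "'K^('n + 'n) \<Rightarrow> 'K^('n + 'n)"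
  assumes g: "g \<in> carrier (Sp k cj)"
  shows "Hilbert_Choice.inv g \<in> carrier (Sp k cj)"
proof -
  note bij = Sp_bij[OF g]
  have add: "g (x + y) = g x + g y" and sc: "c \<in> k \<Longrightarrow> g (c *s x) = c *s g x"
    and form: "symplectic_form cj (g x) (g y) = symplectic_form cj x y" for x y c
    using g by (simp_all add: Sp_def)
  let ?h = "Hilbert_Choice.inv g"
  have gh: "g (?h x) = x" for x by (simp add: bij bij_is_surj surj_f_inv_f)
  have hg: "?h (g x) = x" for x by (simp add: bij bij_is_inj)
  have "?h (x + y) = ?h x + ?h y" for x y
    using hg[of "?h x + ?h y"] by (simp only: add gh)
  moreover have "?h (c *s x) = c *s ?h x" if "c \<in> k" for c x
    using hg[of "c *s ?h x"] by (simp only: sc[OF that] gh)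
  moreover have "symplectic_form cj (?h x) (?h y) = symplectic_form cj x y" for x y
    using form[of "?h x" "?h y"] by (simp only: gh)
  ultimately show ?thesis using bij by (simp add: Sp_def bij_imp_bij_inv)
qed

lemma W_linear: "g \<in> carrier (Sp k cj) \<Longrightarrow> Vector_Spaces.linear scale scale (W g)"
  using representation_W by (simp add: representation_def)

lemmas W_simps = linear_scale_simps[OF W_linear]

lemma W_id: "W id = id"
  using representation_W by (simp add: representation_def Sp_def)

lemma W_compose:
  assumes "f \<in> carrier (Sp k cj)" "g \<in> carrier (Sp k cj)"
  shows "W (g \<circ> f) v = W f (W g v)"
proof -
  have "W (f \<otimes>\<^bsub>Sp k cj\<^esub> g) = W f \<circ> W g"
    using representation_W assms unfolding representation_def by blast
  thus ?thesis by (simp add: Sp_def)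
qed

lemma W_inverse:
  fixes g :: "'K^('n + 'n) \<Rightarrow> 'K^('n + 'n)"
  assumes g: "g \<in> carrier (Sp k cj)"
  shows "W (Hilbert_Choice.inv g) (W g v) = v" "W g (W (Hilbert_Choice.inv g) v) = v"
proof -
  let ?h = "Hilbert_Choice.inv g"
  have "g \<circ> ?h = id" "?h \<circ> g = id"
    using Sp_bij[OF g] by (simp_all add: bij_is_inj bij_is_surj flip: surj_iff)
  thus "W ?h (W g v) = v" "W g (W ?h v) = v"
    using W_compose[OF Sp_inv[OF g] g, of v] W_compose[OF g Sp_inv[OF g], of v] by (simp_all add: W_id)
qed

lemma W_eq_0_iff:
  assumes "g \<in> carrier (Sp k cj)"
  shows "W g v = 0 \<longleftrightarrow> v = 0"
  using W_inverse(1)[OF assms, of v] W_simps(4)[OF assms] W_simps(4)[OF Sp_inv[OF assms]] by auto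

lemma W_\<eta>:
  fixes g :: "'K^('n + 'n) \<Rightarrow> 'K^('n + 'n)"
  assumes g: "g \<in> carrier (Sp k cj)"
  shows "W g (\<eta> (g z, 0) v) = \<eta> (z, 0) (W g v)"
proof -
  have inj: "inj (W g)" by (rule inj_on_inverseI[of _ "W (Hilbert_Choice.inv g)"]) (rule W_inverse(1)[OF g])
  have "(W g \<circ> \<eta> (g z, 0) \<circ> Hilbert_Choice.inv (W g)) (W g v) = \<eta> (Hilbert_Choice.inv g (g z), 0) (W g v)"
    using W_conj[OF g k_zero, of "g z"] by simp
  thus ?thesis using inj Sp_bij[OF g] by (simp add: bij_is_inj)
qed

lemma W_comb:
  assumes g: "g \<in> carrier (Sp k cj)" and b: "\<And>x. W g (b x) = comb (F x)"
  shows "W g (comb f) = comb (\<lambda>z. \<Sum>x\<in>UNIV. f x * F x z)"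
proof -
  have "W g (comb f) = (\<Sum>x\<in>UNIV. scale (f x) (comb (F x)))"
    by (simp add: comb_def[of f] W_simps[OF g] b)
  also have "\<dots> = (\<Sum>x\<in>UNIV. \<Sum>z\<in>UNIV. scale (f x * F x z) (b z))"
    by (simp add: comb_scale) (simp add: comb_def)
  also have "\<dots> = comb (\<lambda>z. \<Sum>x\<in>UNIV. f x * F x z)"
    by (subst sum.swap) (simp add: comb_def V.scale_sum_left)
  finally show ?thesis .
qed

subsection \<open>The operators of the maps preserving the second Lagrangian\<close>

text \<open>Such a map normalizes the group of operators \<open>Y y\<close>, so \<open>W g\<close> preserves the line of vectors fixed
  by them.\<close>

lemma W_v0:
  fixes g :: "'K^('n + 'n) \<Rightarrow> 'K^('n + 'n)"
  assumes g: "g \<in> carrier (Sp k cj)" and Y: "\<And>y. \<exists>y'. g (hpair 0 y) = hpair 0 y'"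
  shows "\<exists>c. c \<noteq> 0 \<and> W g v0 = scale c v0"
proof -
  have "Y y (W g v0) = W g v0" for y
  proof -
    obtain y' where "g (hpair 0 y) = hpair 0 y'" using Y by blast
    hence "\<eta> (g (hpair 0 y), 0) v0 = v0" using Y_v0[of y'] by (simp add: Y_def)
    thus ?thesis using W_\<eta>[OF g, of "hpair 0 y" v0] by (simp add: Y_def)
  qed
  then obtain c where c: "W g v0 = scale c v0" using Y_invariant by blast
  moreover have "c \<noteq> 0"
    using c W_eq_0_iff[OF g, of v0] v0_neq_0 by auto
  ultimately show ?thesis by blast
qed

lemma W_hscale:
  fixes T T' :: "'K^'n \<Rightarrow> 'K^'n"
  assumes g: "hscale T T' \<in> carrier (Sp k cj)" and T': "T' 0 = 0" and T: "T 0 = 0"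
    and c: "W (hscale T T') v0 = scale c v0"
  shows "W (hscale T T') (b (T x)) = scale c (b x)"
proof -
  have "W (hscale T T') (b (T x)) = \<eta> (hpair x 0, 0) (W (hscale T T') v0)"
    using W_\<eta>[OF g, of "hpair x 0" v0] by (simp add: b_def X_def T')
  thus ?thesis by (simp add: c b_def X_def[symmetric] X_simps)
qed

lemma W_hscale_v0:
  fixes T T' :: "'K^'n \<Rightarrow> 'K^'n"
  assumes "hscale T T' \<in> carrier (Sp k cj)" "T 0 = 0"
  shows "\<exists>c. c \<noteq> 0 \<and> W (hscale T T') v0 = scale c v0"
  using assms by (intro W_v0) simp_all

lemma k_linear_0:
  assumes "k_linear f"
  shows "f (0 :: 'K^'n) = 0"
proof -
  have "f 0 + f 0 = f 0 + 0" using assms unfolding k_linear_def by (metis add.right_neutral)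
  thus ?thesis by (rule add_left_imp_eq)
qed

lemma W_shear_up_to_scalar:
  fixes f :: "'K^'n \<Rightarrow> 'K^'n"
  assumes f: "k_symmetric f" and a: "W (shear f) v0 = scale a v0"
  shows "W (shear f) (b x) = scale (a * \<psi> (- (inverse 2 * herm cj x (f x)))) (b x)"
proof -
  note g = shear_in_Sp[OF f]
  let ?p = "\<psi> (inverse 2 * herm cj x (f x))"
  have "X x (W (shear f) v0) = W (shear f) (\<eta> (hpair x (f x), 0) v0)"
    using W_\<eta>[OF g, of "hpair x 0" v0] by (simp add: X_def)
  also have "\<dots> = scale ?p (W (shear f) (b x))"
    by (simp add: \<eta>_hpair W_simps[OF g] b_def)
  finally have "scale ?p (W (shear f) (b x)) = scale a (b x)"
    by (simp add: a X_simps b_def)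
  hence "scale (\<psi> (- (inverse 2 * herm cj x (f x)))) (scale ?p (W (shear f) (b x)))
      = scale (\<psi> (- (inverse 2 * herm cj x (f x)))) (scale a (b x))" by simp
  thus ?thesis by (simp only: V.scale_scale \<psi>_minus_mult V.scale_one mult.commute[of a])
qed

lemma k_symmetric_scale:
  fixes f :: "'K^'n \<Rightarrow> 'K^'n"
  assumes "k_symmetric f" "r \<in> k"
  shows "k_symmetric (\<lambda>x. r *s f x)"
  using assms
  by (auto simp: k_symmetric_def k_linear_def vector_add_ldistrib vector_smult_assoc mult.commute
      trace_form_scale)

lemma shear_scalar_additive:
  fixes f g :: "'K^'n \<Rightarrow> 'K^'n"
  assumes f: "k_symmetric f" "W (shear f) v0 = scale a v0"
    and g: "k_symmetric g" "W (shear g) v0 = scale a' v0"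
  shows "W (shear (\<lambda>x. f x + g x)) v0 = scale (a * a') v0"
proof -
  have "shear (\<lambda>x. f x + g x) = shear g \<circ> shear f"
  proof
    fix z :: "'K^('n + 'n)"
    obtain x y where "z = hpair x y" by (rule hpair_exhaust)
    thus "shear (\<lambda>x. f x + g x) z = (shear g \<circ> shear f) z" by (simp add: add.assoc)
  qed
  thus ?thesis
    using W_compose[OF shear_in_Sp[OF f(1)] shear_in_Sp[OF g(1)], of v0] f g
    by (simp add: W_simps[OF shear_in_Sp[OF f(1)]] mult.commute)
qed

text \<open>Conjugating by the scalar \<open>r \<in> k\<close> turns the shear of \<open>f\<close> into that of \<open>r\<^sup>2f\<close>; hence the scalar of
  the shear of \<open>(r\<^sup>2 - 1)f\<close> is 1.\<close>

lemma W_shear_v0: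
  fixes f :: "'K^'n \<Rightarrow> 'K^'n"
  assumes f: "k_symmetric f"
  shows "W (shear f) v0 = v0"
proof -
  obtain r where r: "r \<in> k" "r \<noteq> 0" "r * r - 1 \<noteq> 0" using exists_nontrivial_square[OF q_gt_3] .
  let ?s = "r * r - 1"
  have s: "?s \<in> k" using r by (simp add: k_diff k_mult)
  define f1 where "f1 x = inverse ?s *s f x" for x
  define f2 where "f2 x = (r * r) *s f1 x" for x
  have sym1: "k_symmetric f1" unfolding f1_def by (intro k_symmetric_scale f k_inverse s)
  have sym2: "k_symmetric f2" unfolding f2_def by (intro k_symmetric_scale sym1 k_mult r)
  have f2: "f2 x = f1 x + f x" for x
  proof -
    have "f x = ?s *s f1 x" using r(3) by (simp add: f1_def vector_smult_assoc)
    hence "f1 x + f x = (1 + ?s) *s f1 x" by (simp add: vector_sadd_rdistrib)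
    thus ?thesis by (simp add: f2_def)
  qed
  have W0: "\<exists>c. c \<noteq> 0 \<and> W (shear h) v0 = scale c v0" if "k_symmetric h" for h
    by (rule W_v0[OF shear_in_Sp[OF that]]) (use that in \<open>simp add: k_symmetric_def k_linear_0\<close>)
  obtain a where a: "W (shear f) v0 = scale a v0" using W0[OF f] by blast
  obtain a1 where a1: "a1 \<noteq> 0" "W (shear f1) v0 = scale a1 v0" using W0[OF sym1] by blast
  obtain a2 where a2: "W (shear f2) v0 = scale a2 v0" using W0[OF sym2] by blast
  define D where "D = hscale ((*s) r) ((*s) (inverse r) :: 'K^'n \<Rightarrow> 'K^'n)"
  have D: "D \<in> carrier (Sp k cj)"
    unfolding D_def
    by (rule hscale_in_Sp[where U = "(*s) (inverse r)" and U' = "(*s) r"])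
      (use r in \<open>auto simp: k_linear_def vector_add_ldistrib vector_smult_assoc mult.commute
        trace_form_scale k_inverse\<close>)
  obtain m where m: "m \<noteq> 0" "W D v0 = scale m v0"
    unfolding D_def using W_hscale_v0[OF D[unfolded D_def]] by auto
  (* D is the action of r, and it conjugates the shears of f1 and of f2 = r^2 f1 = f1 + f *)
  have "shear f1 \<circ> D = D \<circ> shear f2"
  proof
    fix z :: "'K^('n + 'n)"
    obtain x y where z: "z = hpair x y" by (rule hpair_exhaust)
    have "f1 (r *s x) = r *s f1 x" using sym1 r(1) by (simp add: k_symmetric_def k_linear_def)
    thus "(shear f1 \<circ> D) z = (D \<circ> shear f2) z"
      using r(2) by (simp add: z D_def f2_def vector_add_ldistrib vector_smult_assoc mult.assoc[symmetric])
  qed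
  hence "W D (W (shear f1) v0) = W (shear f2) (W D v0)"
    using W_compose[OF D shear_in_Sp[OF sym1], of v0] W_compose[OF shear_in_Sp[OF sym2] D, of v0] by simp
  hence "scale (m * (a1 - a2)) v0 = 0"
    by (simp add: m(2) a1(2) a2 W_simps[OF D] W_simps[OF shear_in_Sp[OF sym2]] algebra_simps
        V.scale_left_diff_distrib)
  hence "a2 = a1" using v0_neq_0 m(1) by simp
  moreover have "scale (a1 * a) v0 = scale a2 v0"
    using shear_scalar_additive[OF sym1 a1(2) f a] a2 by (simp add: f2[abs_def])
  ultimately have "a = 1" using v0_neq_0 a1(1) by simp
  thus ?thesis using a by simp
qed

lemma W_shear:
  fixes f :: "'K^'n \<Rightarrow> 'K^'n"
  assumes f: "k_symmetric f"
  shows "W (shear f) (b x) = scale (\<psi> (- (inverse 2 * herm cj x (f x)))) (b x)"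
  using W_shear_up_to_scalar[OF f, of 1 x] W_shear_v0[OF f] by simp

lemma W_shear_comb:
  fixes f :: "'K^'n \<Rightarrow> 'K^'n"
  assumes f: "k_symmetric f"
  shows "W (shear f) (comb u) = comb (\<lambda>x. u x * \<psi> (- (inverse 2 * herm cj x (f x))))"
  unfolding comb_def W_simps[OF shear_in_Sp[OF f]] W_shear[OF f] by simp

lemma W_exchange_v0: "\<exists>c. c \<noteq> 0 \<and> W exchange v0 = comb (\<lambda>_. c)"
proof -
  have "X x (W exchange v0) = W exchange v0" for x
    using W_\<eta>[OF exchange_in_Sp, of "hpair x 0" v0] Y_v0[of x] by (simp add: X_def Y_def)
  then obtain c where c: "W exchange v0 = comb (\<lambda>_. c)" using X_invariant by blast
  moreover have "c \<noteq> 0"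
  proof
    assume "c = 0"
    hence "W exchange v0 = 0" using c by (simp add: comb_def)
    thus False using W_eq_0_iff[OF exchange_in_Sp] v0_neq_0 by simp
  qed
  ultimately show ?thesis by blast
qed

lemma W_exchange:
  assumes "W exchange v0 = comb (\<lambda>_. c)"
  shows "W exchange (b x) = comb (\<lambda>z. c * \<psi> (- herm cj x z))"
proof -
  have "W exchange (b x) = Y (- x) (W exchange v0)"
    using W_\<eta>[OF exchange_in_Sp, of "hpair 0 (- x)" v0] by (simp add: X_def Y_def b_def)
  also have "\<dots> = comb (\<lambda>z. c * \<psi> (herm cj z (- x)))"
    by (simp add: assms Y_comb)
  also have "(\<lambda>z. c * \<psi> (herm cj z (- x))) = (\<lambda>z. c * \<psi> (- herm cj x z))"
    by (simp add: fun_eq_iff herm_minus_right) (metis \<psi>_cj cj_herm cj_minus)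
  finally show ?thesis .
qed

text \<open>Write \<open>u(f)\<close> for the shear of \<open>f\<close>, \<open>h\<close> for \<open>hscale S S'\<close> and \<open>w\<close> for the exchange. Both sides of
  \<open>w u(S') = u(-S) h w u(-S) w\<close> are applied to the invariant vector, and the coefficients at \<open>b 0\<close> are
  compared: the left side gives the scalar \<open>c\<close> of \<open>w\<close>, the right side \<open>mc\<^sup>2\<close> times the Gauss sum of \<open>S\<close>.\<close>

lemma W_symmetric_scalar:
  fixes S S' :: "'K^'n \<Rightarrow> 'K^'n"
  assumes S: "k_symmetric S" and S': "k_linear S'" "\<And>x. S (S' x) = x" "\<And>x. S' (S x) = x"
    and c: "c \<noteq> 0" "W exchange v0 = comb (\<lambda>_. c)"
  shows "hscale S S' \<in> carrier (Sp k cj)"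
    and "W (hscale S S') v0 = scale m v0 \<Longrightarrow>
      m * c * (\<Sum>x\<in>UNIV. \<psi> (inverse 2 * herm cj x (S x))) = 1"
proof -
  have tr: "trace_form x (S y) = trace_form (S x) y" for x y
    using S by (simp add: k_symmetric_def)
  have "trace_form (S x) (S' y) = trace_form x y" for x y
    using tr[of x "S' y"] by (simp add: S'(2))
  thus g: "hscale S S' \<in> carrier (Sp k cj)"
    using S S' by (intro hscale_in_Sp[where U = S' and U' = S]) (simp_all add: k_symmetric_def)
  assume m: "W (hscale S S') v0 = scale m v0"
  have symS': "k_symmetric S'"
    unfolding k_symmetric_def
  proof (intro conjI allI S'(1))
    show "trace_form x (S' y) = trace_form (S' x) y" for x y
      using tr[of "S' x" "S' y"] by (simp add: S'(2))
  qed
  define N where "N x = - S x" for x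
  have symN: "k_symmetric N"
    using S unfolding N_def
    by (auto simp: k_symmetric_def k_linear_def trace_form_minus vector_smult_rneg)
  have S0: "S 0 = 0" "S' 0 = 0" using S S' by (simp_all add: k_symmetric_def k_linear_0)
  note ex = exchange_in_Sp and sN = shear_in_Sp[OF symN] and sS' = shear_in_Sp[OF symS']
  have "shear S' \<circ> exchange = exchange \<circ> (shear N \<circ> (exchange \<circ> (hscale S S' \<circ> shear N)))"
  proof
    fix z :: "'K^('n + 'n)"
    obtain x y where z: "z = hpair x y" by (rule hpair_exhaust)
    have add: "S (u + v) = S u + S v" "S' (u + v) = S' u + S' v" for u v
      using S S' by (simp_all add: k_symmetric_def k_linear_def)
    have neg: "S (- u) = - S u" "S' (- u) = - S' u" for u
      using add(1)[of u "- u"] add(2)[of u "- u"] S0 by (simp_all add: eq_neg_iff_add_eq_0 add.commute)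
    have sub: "S (u - v) = S u - S v" "S' (u - v) = S' u - S' v" for u v
      using add(1)[of u "- v"] add(2)[of u "- v"] by (simp_all add: neg)
    show "(shear S' \<circ> exchange) z = (exchange \<circ> (shear N \<circ> (exchange \<circ> (hscale S S' \<circ> shear N)))) z"
      by (simp add: z N_def add neg sub S'(2,3))
  qed
  hence "W (shear S' \<circ> exchange) v0
      = W (exchange \<circ> (shear N \<circ> (exchange \<circ> (hscale S S' \<circ> shear N)))) v0" by simp
  moreover have "W (shear S' \<circ> exchange) v0 = comb (\<lambda>_. c)"
    by (simp add: W_compose[OF ex sS'] W_shear_v0[OF symS'] c)
  moreover have "W (exchange \<circ> (shear N \<circ> (exchange \<circ> (hscale S S' \<circ> shear N)))) v0
      = W (shear N) (W (hscale S S') (W exchange (W (shear N) (W exchange v0))))"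
    by (simp add: W_compose Sp_compose ex sN g)
  moreover have "W exchange (W (shear N) (W exchange v0))
      = comb (\<lambda>z. \<Sum>x\<in>UNIV. c * \<psi> (inverse 2 * herm cj x (S x)) * (c * \<psi> (- herm cj x z)))" (is "_ = comb ?F")
    unfolding c(2) W_shear_comb[OF symN] W_comb[OF ex W_exchange[OF c(2)]]
    by (simp add: N_def herm_minus_right)
  moreover have "W (hscale S S') (comb ?F) = comb (\<lambda>z. m * ?F (S z))"
  proof -
    have "comb ?F = (\<Sum>z\<in>UNIV. scale (?F (S z)) (b (S z)))"
      unfolding comb_def
      by (rule sum.reindex_bij_witness[of _ S S']) (simp_all add: S')
    hence "W (hscale S S') (comb ?F) = (\<Sum>z\<in>UNIV. scale (?F (S z)) (scale m (b z)))"
      by (simp only: W_simps[OF g] W_hscale[OF g S0(2,1) m])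
    thus ?thesis by (simp add: comb_def mult.commute)
  qed
  ultimately have "comb (\<lambda>_. c) = W (shear N) (comb (\<lambda>z. m * ?F (S z)))" by simp
  hence "comb (\<lambda>_. c) = comb (\<lambda>z. m * ?F (S z) * \<psi> (- (inverse 2 * herm cj z (N z))))"
    by (simp only: W_shear_comb[OF symN])
  from comb_eqD[OF this, of 0] have "c = m * ?F 0" by (simp add: S0)
  also have "\<dots> = c * (m * c * (\<Sum>x\<in>UNIV. \<psi> (inverse 2 * herm cj x (S x))))"
    by (simp add: sum_distrib_left mult_ac)
  finally show "m * c * (\<Sum>x\<in>UNIV. \<psi> (inverse 2 * herm cj x (S x))) = 1"
    using c(1) by simp
qed

end

section \<open>The Weil operators of the unitary group\<close>

context Weil_setting
begin

lemma matrix_action_mult: "matrix_action (A ** B) = matrix_action B \<circ> matrix_action A"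
  by (simp add: matrix_action_def fun_eq_iff vector_matrix_mul_assoc)

lemma matrix_action_in_Sp:
  fixes A :: "'K^('n + 'n)^('n + 'n)"
  assumes A: "A \<in> carrier (SL_star cj)"
  shows "matrix_action A \<in> carrier (Sp k cj)"
proof (rule Sp_I[where h = "matrix_action (w_elt ** mstar cj A ** - w_elt)"])
  have AwA: "A ** w_elt ** mstar cj A = w_elt" using A by (simp add: SL_star_iff)
  have skew: "skew_hermitian_form cj (z v* A) (z' v* A) = skew_hermitian_form cj z z'" for z z'
  proof -
    have "skew_hermitian_form cj (z v* A) (z' v* A) = herm cj (z v* A v* w_elt) (z' v* A)"
      by (simp add: skew_hermitian_form_def herm_def w_elt_def)
    also have "\<dots> = herm cj (z v* A v* w_elt v* mstar cj A) z'"
      by (simp add: herm_times_matrix)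
    also have "\<dots> = herm cj (z v* w_elt) z'"
      by (simp only: vector_matrix_mul_assoc AwA)
    also have "\<dots> = skew_hermitian_form cj z z'"
      by (simp add: skew_hermitian_form_def herm_def w_elt_def)
    finally show ?thesis .
  qed
  fix x y x' y' :: "'K^'n"
  show "symplectic_form cj (matrix_action A (hpair x y)) (matrix_action A (hpair x' y'))
      = symplectic_form cj (hpair x y) (hpair x' y')"
    by (simp only: symplectic_form_def matrix_action_def skew)
  show "matrix_action A (hpair (x + x') (y + y')) = matrix_action A (hpair x y) + matrix_action A (hpair x' y')"
    by (simp only: matrix_action_def hpair_add[symmetric] vector_matrix_left_distrib)
  show "matrix_action (w_elt ** mstar cj A ** - w_elt) (matrix_action A (hpair x y)) = hpair x y"
  proof -
    have "A ** (w_elt ** mstar cj A ** - w_elt) = mat 1"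
      using AwA w_elt_inverse by (simp add: matrix_mul_assoc)
    thus ?thesis by (simp only: matrix_action_def vector_matrix_mul_assoc vector_matrix_mul_rid)
  qed
next
  fix c and x y :: "'K^'n"
  show "matrix_action A (hpair (c *s x) (c *s y)) = c *s matrix_action A (hpair x y)"
    by (simp only: matrix_action_def hpair_scale[symmetric] scalar_vector_matrix_assoc)
qed

lemma function_eq_hpairI:
  fixes g h :: "'K^('n + 'n) \<Rightarrow> 'a"
  assumes "\<And>x y. g (hpair x y) = h (hpair x y)"
  shows "g = h"
proof
  fix z :: "'K^('n + 'n)"
  obtain x y where "z = hpair x y" by (rule hpair_exhaust)
  thus "g z = h z" using assms by simp
qed

lemma matrix_action_h: "matrix_action (h_elt cj t)
    = hscale (\<lambda>x. x v* t) (\<lambda>y. y v* matrix_inv (mstar cj (t :: 'K^'n^'n)))"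
  by (rule function_eq_hpairI) (simp add: matrix_action_def h_elt_def)

lemma matrix_action_w: "matrix_action w_elt = (exchange :: 'K^('n + 'n) \<Rightarrow> _)"
  by (rule function_eq_hpairI) (simp add: matrix_action_def w_elt_def vector_matrix_neg)

lemma matrix_action_u: "matrix_action (u_elt s) = shear (\<lambda>x. x v* (s :: 'K^'n^'n))"
  by (rule function_eq_hpairI) (simp add: matrix_action_def u_elt_def add.commute)

lemma k_symmetric_matrix:
  fixes s :: "'K^'n^'n"
  assumes "mstar cj s = s"
  shows "k_symmetric (\<lambda>x. x v* s)"
  using assms
  by (simp add: k_symmetric_def k_linear_def vector_matrix_left_distrib scalar_vector_matrix_assoc
      trace_form_def herm_times_matrix)

subsection \<open>The character of the general linear group\<close>

text \<open>The diagonal matrix of \<open>d\<close> is the composite of \<open>conj_scaling d\<close> and \<open>conj_scaling 1\<close>. Both are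
  symmetric for the trace form, whereas the matrix is hermitian only if its entries lie in \<open>k\<close>.\<close>

definition conj_scaling :: "'K^'n \<Rightarrow> 'K^'n \<Rightarrow> 'K^'n" where
  "conj_scaling d x = (\<chi> i. cj (d $ i * x $ i))"

lemma k_linear_conj_scaling: "k_linear (conj_scaling d)"
  by (simp add: k_linear_def conj_scaling_def vec_eq_iff distrib_left cj_add cj_mult cj_k mult_ac)

lemma herm_conj_scaling: "herm cj x (conj_scaling d y) = (\<Sum>i\<in>UNIV. d $ i * (x $ i * y $ i))"
  by (simp add: herm_def conj_scaling_def mult_ac)

lemma k_symmetric_conj_scaling: "k_symmetric (conj_scaling d)"
proof -
  have "trace_form x (conj_scaling d y) = trace_form (conj_scaling d x) y" for x y
    unfolding trace_form_commute[of "conj_scaling d x" y]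
    by (simp add: trace_form_def herm_conj_scaling mult_ac)
  thus ?thesis by (simp add: k_symmetric_def k_linear_conj_scaling)
qed

definition conj_unscaling :: "'K^'n \<Rightarrow> 'K^'n \<Rightarrow> 'K^'n" where
  "conj_unscaling d = conj_scaling (\<chi> i. inverse (cj (d $ i)))"

lemma conj_scaling_inverse:
  assumes "\<And>i. d $ i \<noteq> 0"
  shows "conj_scaling d (conj_unscaling d x) = x" "conj_unscaling d (conj_scaling d x) = x"
  using assms
  by (simp_all add: conj_scaling_def conj_unscaling_def vec_eq_iff cj_mult cj_inverse)

definition GL_scalar :: "'K^'n^'n \<Rightarrow> complex" where
  "GL_scalar t = (SOME m. m \<noteq> 0 \<and> W (matrix_action (h_elt cj t)) v0 = scale m v0)"

lemma GL_scalar: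
  assumes "invertible t"
  shows "GL_scalar t \<noteq> 0" "W (matrix_action (h_elt cj t)) v0 = scale (GL_scalar t) v0"
proof -
  have "\<exists>m. m \<noteq> 0 \<and> W (matrix_action (h_elt cj t)) v0 = scale m v0"
    using matrix_action_in_Sp[OF h_elt_in_SL_star[OF assms]]
    unfolding matrix_action_h by (intro W_hscale_v0) simp_all
  from someI_ex[OF this] show "GL_scalar t \<noteq> 0" "W (matrix_action (h_elt cj t)) v0 = scale (GL_scalar t) v0"
    by (simp_all add: GL_scalar_def)
qed

lemma scale_v0_eq_iff: "scale a v0 = scale a' v0 \<longleftrightarrow> a = a'"
  using v0_neq_0 by simp

lemma GL_scalar_mult:
  assumes "invertible s" "invertible t"
  shows "GL_scalar (s ** t) = GL_scalar s * GL_scalar t"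
proof -
  note mem = matrix_action_in_Sp[OF h_elt_in_SL_star]
  have "W (matrix_action (h_elt cj (s ** t))) v0
      = W (matrix_action (h_elt cj s)) (W (matrix_action (h_elt cj t)) v0)"
    unfolding h_elt_mult[OF assms] matrix_action_mult
    by (rule W_compose[OF mem[OF assms(1)] mem[OF assms(2)]])
  hence "scale (GL_scalar (s ** t)) v0 = scale (GL_scalar s * GL_scalar t) v0"
    using assms by (simp add: GL_scalar invertible_mult W_simps[OF mem[OF assms(1)]] mult.commute)
  thus ?thesis by (simp only: scale_v0_eq_iff)
qed

lemma W_h:
  assumes "invertible t"
  shows "W (matrix_action (h_elt cj t)) (b (x v* t)) = scale (GL_scalar t) (b x)"
  using matrix_action_in_Sp[OF h_elt_in_SL_star[OF assms]] GL_scalar(2)[OF assms]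
  unfolding matrix_action_h by (intro W_hscale) simp_all

lemma matrix_action_dilation:
  fixes j :: 'n and d :: 'K
  assumes d: "d \<noteq> 0"
  defines "dv \<equiv> (\<chi> i. if i = j then d else 1) :: 'K^'n"
  shows "matrix_action (h_elt cj (row_replacement j (axis j d)))
    = hscale (conj_scaling 1) (conj_unscaling 1) \<circ> hscale (conj_scaling dv) (conj_unscaling dv)"
proof -
  have star: "mstar cj (row_replacement j (axis j e)) = row_replacement j (axis j (cj e))" for e
    by (auto simp: mstar_def row_replacement_def axis_def vec_eq_iff)
  have "row_replacement j (axis j (cj d)) ** row_replacement j (axis j (inverse (cj d))) = mat 1"
  proof -
    have "axis j (cj d) + axis j (cj d) $ j *s (axis j (inverse (cj d)) - axis j 1) = axis j 1"
      using d by (auto simp: vec_eq_iff axis_def algebra_simps)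
    thus ?thesis by (simp only: row_replacement_mult row_replacement_self)
  qed
  hence inv: "matrix_inv (mstar cj (row_replacement j (axis j d))) = row_replacement j (axis j (inverse (cj d)))"
    unfolding star by (rule matrix_inv_eqI)
  have "x v* row_replacement j (axis j d) = conj_scaling 1 (conj_scaling dv x)" for x
    by (auto simp: times_row_replacement conj_scaling_def dv_def vec_eq_iff axis_def algebra_simps)
  moreover have "y v* row_replacement j (axis j (inverse (cj d))) = conj_unscaling 1 (conj_unscaling dv y)" for y
    by (auto simp: times_row_replacement conj_scaling_def conj_unscaling_def dv_def vec_eq_iff axis_def
        algebra_simps)
  ultimately show ?thesis
    unfolding matrix_action_h inv by (intro function_eq_hpairI) simp
qed

text \<open>The Gauss sums of the two conjugate-linear factors differ by \<open>sg d\<close>, hence so do their scalars; and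
  the scalar of \<open>conj_scaling 1\<close>, an involution, has square 1.\<close>

lemma GL_scalar_dilation:
  fixes j :: 'n and d :: 'K
  assumes sg: "nontrivial_quadratic_character sg" and d: "d \<noteq> 0"
  shows "GL_scalar (row_replacement j (axis j d)) = sg d"
proof -
  define dv :: "'K^'n" where "dv = (\<chi> i. if i = j then d else 1)"
  obtain c where c: "c \<noteq> 0" "W exchange v0 = comb (\<lambda>_. c)" using W_exchange_v0 by blast
  have nz: "dv $ i \<noteq> 0" "(1 :: 'K^'n) $ i \<noteq> 0" for i using d by (simp_all add: dv_def)
  let ?h = "\<lambda>d. hscale (conj_scaling d) (conj_unscaling d)"
  let ?G = "\<lambda>d. \<Sum>x\<in>UNIV. \<psi> (inverse 2 * herm cj x (conj_scaling d x))"
  have mem: "?h e \<in> carrier (Sp k cj)"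
    and scalar: "W (?h e) v0 = scale m v0 \<Longrightarrow> m * c * ?G e = 1"
    if "\<And>i. e $ i \<noteq> 0" for e :: "'K^'n" and m
  proof -
    have lin: "k_linear (conj_unscaling e)"
      unfolding conj_unscaling_def by (rule k_linear_conj_scaling)
    note * = W_symmetric_scalar[OF k_symmetric_conj_scaling lin conj_scaling_inverse[OF that] c]
    show "?h e \<in> carrier (Sp k cj)" by (rule *(1))
    show "W (?h e) v0 = scale m v0 \<Longrightarrow> m * c * ?G e = 1" by (rule *(2))
  qed
  have "\<exists>m. m \<noteq> 0 \<and> W (?h e) v0 = scale m v0" if "\<And>i. e $ i \<noteq> 0" for e :: "'K^'n"
    by (rule W_hscale_v0[OF mem[OF that]]) (simp_all add: k_linear_0 k_linear_conj_scaling)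
  then obtain m m1 where m: "W (?h dv) v0 = scale m v0" and m1: "W (?h 1) v0 = scale m1 v0"
    using nz by metis
  have sg1: "sg 1 = 1"
  proof -
    have "sg 1 = (sg 1)\<^sup>2" using sg_mult[OF sg, of 1 1] by (simp only: power2_eq_square mult_1_left one_neq_zero not_False_eq_True)
    thus ?thesis using sg_square[OF sg, of 1] by simp
  qed
  have "(\<Prod>i\<in>UNIV. sg (dv $ i)) = (\<Prod>i\<in>UNIV. if i = j then sg d else 1)"
    by (intro prod.cong) (auto simp: dv_def sg1)
  hence prod_dv: "(\<Prod>i\<in>UNIV. sg (dv $ i)) = sg d" by simp
  have prod_1: "(\<Prod>i\<in>UNIV. sg ((1 :: 'K^'n) $ i)) = 1" by (simp add: sg1)
  have Gd: "?G dv = sg d * ?G 1"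
    by (simp only: herm_conj_scaling gauss_sum_diagonal[OF sg nz(1)] gauss_sum_diagonal[OF sg nz(2)]
        prod_dv prod_1 mult_1_left)
  have "?h 1 \<circ> ?h 1 = (id :: 'K^('n + 'n) \<Rightarrow> _)"
    by (rule function_eq_hpairI)
      (simp add: conj_scaling_def conj_unscaling_def vec_eq_iff)
  hence "W (?h 1) (W (?h 1) v0) = v0"
    using W_compose[OF mem[OF nz(2)] mem[OF nz(2)], of v0] by (simp add: W_id)
  hence "scale (m1 * m1) v0 = scale 1 v0"
    by (simp add: m1 W_simps[OF mem[OF nz(2)]])
  hence m1_sq: "m1 * m1 = 1" by (simp only: scale_v0_eq_iff)
  define G where "G = ?G 1"
  have e: "m * c * (sg d * G) = 1" "m1 * c * G = 1"
    using scalar[OF nz(1) m] scalar[OF nz(2) m1] by (simp_all only: Gd G_def)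
  hence "(m * sg d) * (c * G) = m1 * (c * G)" by (simp only: mult_ac)
  moreover have "c * G \<noteq> 0" using e(2) by auto
  ultimately have "m * sg d = m1" by simp
  have "sg d * sg d = 1" using sg_square[OF sg d] by (simp add: power2_eq_square)
  have "m * m1 = (m * sg d) * sg d * m1"
    using \<open>sg d * sg d = 1\<close> by (simp add: mult.assoc)
  also have "\<dots> = (m1 * m1) * sg d" unfolding \<open>m * sg d = m1\<close> by (simp only: mult_ac)
  finally have mm1: "m * m1 = sg d" by (simp add: m1_sq)
  have "W (matrix_action (h_elt cj (row_replacement j (axis j d)))) v0 = W (?h dv) (W (?h 1) v0)"
    unfolding matrix_action_dilation[OF d] dv_def[symmetric]
    by (rule W_compose[OF mem[OF nz(1)] mem[OF nz(2)]])
  also have "\<dots> = scale (sg d) v0"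
    by (simp add: m m1 W_simps[OF mem[OF nz(1)]] mm1[symmetric] mult.commute)
  finally have "scale (GL_scalar (row_replacement j (axis j d))) v0 = scale (sg d) v0"
    using d by (simp add: GL_scalar invertible_row_replacement)
  thus ?thesis by (simp only: scale_v0_eq_iff)
qed

lemma GL_scalar_eq:
  assumes sg: "nontrivial_quadratic_character sg" and t: "invertible t"
  shows "GL_scalar t = sg (det t)"
proof (rule GL_character_eqI[OF two_neq_0 _ _ _ _ _ t])
  fix s t :: "'K^'n^'n" assume "invertible s" "invertible t"
  thus "sg (det (s ** t)) = sg (det s) * sg (det t)"
    by (simp add: det_mul sg_mult[OF sg] invertible_det_nz)
next
  fix t :: "'K^'n^'n" assume "invertible t"
  hence "det t \<noteq> 0" by (simp add: invertible_det_nz)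
  from sg_square[OF sg this] show "sg (det t) \<noteq> 0" by auto
qed (simp_all add: GL_scalar_mult GL_scalar GL_scalar_dilation[OF sg] det_dilation)

end

section \<open>The comparison\<close>

locale Weil_comparison = Weil_setting k cj q \<psi> \<phi> scale \<eta> W
  for k :: "'K::{field,finite} set" and cj q \<psi> \<phi> and scale :: "complex \<Rightarrow> 'v::ab_group_add \<Rightarrow> 'v"
    and \<eta> :: "('K^('n::finite + 'n)) \<times> 'K \<Rightarrow> 'v \<Rightarrow> 'v" and W +
  fixes sg :: "'K \<Rightarrow> complex" and c :: complex
    and \<rho> :: "'K^('n + 'n)^('n + 'n) \<Rightarrow> complex^('K^'n) \<Rightarrow> complex^('K^'n)"
  assumes quadratic_sg: "nontrivial_quadratic_character sg"
    and c_neq_0: "c \<noteq> 0"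
    and generalized_Weil: "generalized_Weil_representation cj sg \<psi> c \<rho>"
begin

lemma representation_\<rho>: "representation (SL_star cj) (*s) \<rho>"
  and \<rho>_u: "mstar cj s = s \<Longrightarrow> \<rho> (u_elt s) (axis a 1) = gamma_fun cj \<psi> s a *s axis a 1"
  and \<rho>_h: "invertible t \<Longrightarrow> \<rho> (h_elt cj t) (axis a 1) = sg (det t) *s axis (a v* matrix_inv t) 1"
  and \<rho>_w: "\<rho> w_elt (axis a 1) = c *s (\<Sum>b\<in>UNIV. chi_fun cj \<psi> a b *s axis b 1)"
  using generalized_Weil by (simp_all add: generalized_Weil_representation_def)

lemma \<rho>_linear: "A \<in> carrier (SL_star cj) \<Longrightarrow> Vector_Spaces.linear (*s) (*s) (\<rho> A)"
  using representation_\<rho> by (simp add: representation_def)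

lemma \<rho>_mult:
  assumes "A \<in> carrier (SL_star cj)" "A' \<in> carrier (SL_star cj)"
  shows "\<rho> (A ** A') v = \<rho> A (\<rho> A' v)"
proof -
  have "\<rho> (A \<otimes>\<^bsub>SL_star cj\<^esub> A') = \<rho> A \<circ> \<rho> A'"
    using representation_\<rho> assms unfolding representation_def by blast
  thus ?thesis by (simp add: SL_star_def)
qed

lemma W_action_mult:
  assumes "A \<in> carrier (SL_star cj)" "A' \<in> carrier (SL_star cj)"
  shows "W (matrix_action (A ** A')) v = W (matrix_action A) (W (matrix_action A') v)"
  unfolding matrix_action_mult
  by (rule W_compose[OF matrix_action_in_Sp[OF assms(1)] matrix_action_in_Sp[OF assms(2)]])

definition \<kappa> :: 'K where "\<kappa> = (SOME x. x * cj x = - 1)"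

lemma norm_\<kappa>: "\<kappa> * cj \<kappa> = - 1"
proof -
  have "\<exists>x. x * cj x = - 1" by (rule exists_norm_minus_one) blast
  thus ?thesis unfolding \<kappa>_def by (rule someI_ex)
qed

lemma \<kappa>_neq_0 [simp]: "\<kappa> \<noteq> 0"
  using norm_\<kappa> by auto

lemma herm_\<kappa>: "herm cj (\<kappa> *s x) (\<kappa> *s y) = - herm cj x y"
proof -
  have "herm cj (\<kappa> *s x) (\<kappa> *s y) = (\<kappa> * cj \<kappa>) * herm cj x y"
    by (simp only: herm_scale_left herm_scale_right mult_ac)
  thus ?thesis by (simp add: norm_\<kappa>)
qed

text \<open>The inverse of the intertwining map. The factor \<open>\<kappa>\<close> is there because the operators \<open>W\<close> in the basis
  \<open>b\<close> and the operators \<open>\<rho>\<close> differ in the sign of the hermitian form.\<close>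

definition B :: "complex^('K^'n) \<Rightarrow> 'v" where
  "B u = (\<Sum>a\<in>UNIV. scale (u $ a) (b (\<kappa> *s a)))"

lemma B_eq_comb: "B u = comb (\<lambda>x. u $ (inverse \<kappa> *s x))"
  unfolding B_def comb_def
  by (rule sum.reindex_bij_witness[of _ "\<lambda>x. inverse \<kappa> *s x" "\<lambda>a. \<kappa> *s a"])
    (simp_all add: vector_smult_assoc)

lemma B_linear: "Vector_Spaces.linear (*s) scale B"
  unfolding Vector_Spaces.linear_iff
  by (simp add: vec.vector_space_axioms V.vector_space_axioms B_def V.scale_left_distrib sum.distrib
      V.scale_sum_right)

lemmas B_simps = linear_scale_simps[OF B_linear]

lemma B_axis: "B (axis a 1) = b (\<kappa> *s a)"
proof -
  have "B (axis a 1) = (\<Sum>x\<in>UNIV. if x = a then b (\<kappa> *s a) else 0)"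
    unfolding B_def by (intro sum.cong) (auto simp: axis_def)
  thus ?thesis by simp
qed

lemma bij_B: "bij B"
proof (rule bijI)
  show "inj B"
  proof (rule injI)
    fix u u' assume "B u = B u'"
    hence eq: "comb (\<lambda>x. u $ (inverse \<kappa> *s x)) = comb (\<lambda>x. u' $ (inverse \<kappa> *s x))"
      by (simp only: B_eq_comb)
    have "u $ a = u' $ a" for a
      using comb_eqD[OF eq, of "\<kappa> *s a"] by (simp add: vector_smult_assoc)
    thus "u = u'" by (simp add: vec_eq_iff)
  qed
  show "surj B"
    unfolding surj_def
  proof
    fix v
    obtain f where "v = comb f" using comb_surj by blast
    hence "v = B (\<chi> a. f (\<kappa> *s a))" by (simp add: B_eq_comb vector_smult_assoc)
    thus "\<exists>u. v = B u" ..
  qed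
qed

lemma intertwines_if_on_axes:
  fixes A :: "'K^('n + 'n)^('n + 'n)"
  assumes A: "A \<in> carrier (SL_star cj)"
    and axes: "\<And>a. W (matrix_action A) (B (axis a 1)) = scale l (B (\<rho> A (axis a 1)))"
  shows "W (matrix_action A) (B u) = scale l (B (\<rho> A u))"
proof -
  note W_lin = W_simps[OF matrix_action_in_Sp[OF A]] and \<rho>_lin = linear_scale_simps[OF \<rho>_linear[OF A]]
  have u: "u = (\<Sum>a\<in>UNIV. u $ a *s axis a 1)" by (rule basis_expansion[symmetric])
  have "W (matrix_action A) (B u) = (\<Sum>a\<in>UNIV. scale (u $ a) (W (matrix_action A) (B (axis a 1))))"
    by (subst u) (simp only: B_simps W_lin)
  also have "\<dots> = (\<Sum>a\<in>UNIV. scale l (scale (u $ a) (B (\<rho> A (axis a 1)))))"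
    by (simp add: axes mult.commute)
  also have "\<dots> = scale l (B (\<rho> A (\<Sum>a\<in>UNIV. u $ a *s axis a 1)))"
    by (simp only: B_simps \<rho>_lin V.scale_sum_right)
  also have "(\<Sum>a\<in>UNIV. u $ a *s axis a 1) = u" by (rule u[symmetric])
  finally show ?thesis .
qed

lemma intertwines_u:
  assumes s: "mstar cj s = s"
  shows "W (matrix_action (u_elt s)) (B u) = B (\<rho> (u_elt s) u)"
proof -
  have "W (matrix_action (u_elt s)) (B (axis a 1)) = B (\<rho> (u_elt s) (axis a 1))" for a
  proof -
    have "\<psi> (- (inverse 2 * herm cj (\<kappa> *s a) ((\<kappa> *s a) v* s))) = \<psi> (inverse 2 * herm cj a (a v* s))"
      by (simp add: scalar_vector_matrix_assoc herm_\<kappa>)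
    also have "\<dots> = \<psi> (cj (inverse 2 * herm cj a (a v* s)))" by (simp only: \<psi>_cj)
    also have "\<dots> = gamma_fun cj \<psi> s a"
      by (simp only: gamma_fun_def cj_mult cj_inverse cj_numeral cj_herm)
    finally show ?thesis
      by (simp only: matrix_action_u B_axis W_shear[OF k_symmetric_matrix[OF s]] \<rho>_u[OF s] B_simps)
  qed
  thus ?thesis
    using intertwines_if_on_axes[OF u_elt_in_SL_star[OF s], of 1 u] by simp
qed

lemma intertwines_h:
  assumes t: "invertible t"
  shows "W (matrix_action (h_elt cj t)) (B u) = B (\<rho> (h_elt cj t) u)"
proof -
  have "W (matrix_action (h_elt cj t)) (B (axis a 1)) = B (\<rho> (h_elt cj t) (axis a 1))" for a
  proof -
    have "\<kappa> *s a = (\<kappa> *s (a v* matrix_inv t)) v* t"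
      by (simp only: scalar_vector_matrix_assoc vector_matrix_mul_assoc matrix_inv_mult[OF t]
          vector_matrix_mul_rid)
    hence "W (matrix_action (h_elt cj t)) (B (axis a 1)) = scale (sg (det t)) (b (\<kappa> *s (a v* matrix_inv t)))"
      using W_h[OF t] by (simp only: B_axis GL_scalar_eq[OF quadratic_sg t])
    thus ?thesis by (simp only: \<rho>_h[OF t] B_simps B_axis)
  qed
  thus ?thesis
    using intertwines_if_on_axes[OF h_elt_in_SL_star[OF t], of 1 u] by simp
qed

text \<open>The two actions of \<open>w\<close> agree up to a scalar \<open>l\<close>. The relation of \<open>w\<close> and \<open>u\<^sub>1\<close> has \<open>w\<close> once on one
  side and twice on the other, which gives \<open>l = l\<^sup>2\<close>.\<close>

lemma intertwines_w: "W (matrix_action w_elt) (B u) = B (\<rho> w_elt u)"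
proof -
  obtain c' where c': "c' \<noteq> 0" "W exchange v0 = comb (\<lambda>_. c')" using W_exchange_v0 by blast
  define l where "l = c' / c"
  have l0: "l \<noteq> 0" using c' c_neq_0 by (simp add: l_def)
  have "W (matrix_action w_elt) (B (axis a 1)) = scale l (B (\<rho> w_elt (axis a 1)))" for a
  proof -
    have "W (matrix_action w_elt) (B (axis a 1)) = comb (\<lambda>z. c' * \<psi> (- herm cj (\<kappa> *s a) z))"
      by (simp only: matrix_action_w B_axis W_exchange[OF c'(2)])
    also have "\<dots> = (\<Sum>x\<in>UNIV. scale (c' * \<psi> (- herm cj (\<kappa> *s a) (\<kappa> *s x))) (b (\<kappa> *s x)))"
      unfolding comb_def
      by (rule sum.reindex_bij_witness[of _ "\<lambda>a. \<kappa> *s a" "\<lambda>x. inverse \<kappa> *s x"])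
        (simp_all add: vector_smult_assoc)
    also have "\<dots> = (\<Sum>x\<in>UNIV. scale l (scale c (scale (chi_fun cj \<psi> a x) (b (\<kappa> *s x)))))"
      using c_neq_0 by (simp add: herm_\<kappa> chi_fun_def l_def)
    also have "\<dots> = scale l (B (\<rho> w_elt (axis a 1)))"
      by (simp only: \<rho>_w B_simps B_axis V.scale_sum_right)
    finally show ?thesis .
  qed
  hence W_w: "W (matrix_action w_elt) (B u) = scale l (B (\<rho> w_elt u))" for u
    by (rule intertwines_if_on_axes[OF w_elt_in_SL_star])
  let ?u = "u_elt (mat 1) :: 'K^('n + 'n)^('n + 'n)" and ?v = "u_elt (- mat 1) :: 'K^('n + 'n)^('n + 'n)"
    and ?w = "w_elt :: 'K^('n + 'n)^('n + 'n)"
  have herm1: "mstar cj (mat 1) = (mat 1 :: 'K^'n^'n)" "mstar cj (- mat 1) = (- mat 1 :: 'K^'n^'n)"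
    by (simp_all add: mstar_minus)
  note mem = u_elt_in_SL_star[OF herm1(1)] u_elt_in_SL_star[OF herm1(2)] w_elt_in_SL_star SL_star_mult
  note W_u = intertwines_u[OF herm1(1)] and W_v = intertwines_u[OF herm1(2)]
  have mem_uw: "?w ** ?u \<in> carrier (SL_star cj)" by (intro mem)
  define v where "v = axis (0 :: 'K^'n) (1 :: complex)"
  have "scale l (B (\<rho> (?w ** ?u) v)) = W (matrix_action (?w ** ?u)) (B v)"
    by (simp only: W_action_mult \<rho>_mult mem W_u W_w)
  also have "\<dots> = scale (l * l) (B (\<rho> (?v ** ?w ** ?v ** ?w) v))"
    unfolding w_u_relation
    by (simp only: W_action_mult \<rho>_mult mem W_v W_w V.scale_scale
        W_simps[OF matrix_action_in_Sp[OF mem(2)]] W_simps[OF matrix_action_in_Sp[OF mem(3)]])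
  also have "?v ** ?w ** ?v ** ?w = ?w ** ?u" by (rule w_u_relation[symmetric])
  finally have "scale (l - l * l) (B (\<rho> (?w ** ?u) v)) = 0"
    by (simp add: V.scale_left_diff_distrib)
  moreover have "B (\<rho> (?w ** ?u) v) \<noteq> 0"
  proof
    assume "B (\<rho> (?w ** ?u) v) = 0"
    hence "W (matrix_action (?w ** ?u)) (B v) = 0"
      by (simp only: W_action_mult \<rho>_mult mem W_u W_w V.scale_zero_right)
    hence "B v = 0" using W_eq_0_iff[OF matrix_action_in_Sp[OF mem_uw]] by simp
    thus False using v0_neq_0 by (simp add: v_def B_axis)
  qed
  ultimately have "l = 1" using l0 by simp
  thus ?thesis using W_w by simp
qed

lemma intertwines:
  assumes "A \<in> carrier (SL_star cj)"
  shows "W (matrix_action A) (B u) = B (\<rho> A u)"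
proof -
  have "\<forall>u. W (matrix_action A) (B u) = B (\<rho> A u)"
    using assms
    by (induction rule: SL_star_generated)
      (simp_all add: intertwines_u intertwines_w intertwines_h W_action_mult \<rho>_mult)
  thus ?thesis ..
qed

lemma equivalent: "equivalent_representations (SL_star cj) scale (\<lambda>A. W (matrix_action A)) (*s) \<rho>"
  unfolding equivalent_representations_def
proof (intro conjI exI ballI)
  show "representation (SL_star cj) scale (\<lambda>A. W (matrix_action A))"
    unfolding representation_def
  proof (intro conjI ballI vector_space_scale)
    fix A A' :: "'K^('n + 'n)^('n + 'n)"
    assume A: "A \<in> carrier (SL_star cj)"
    show "Vector_Spaces.linear scale scale (W (matrix_action A))"
      by (rule W_linear[OF matrix_action_in_Sp[OF A]])
    assume A': "A' \<in> carrier (SL_star cj)"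
    show "W (matrix_action (A \<otimes>\<^bsub>SL_star cj\<^esub> A')) = W (matrix_action A) \<circ> W (matrix_action A')"
      using W_action_mult[OF A A'] by (simp add: SL_star_def fun_eq_iff)
  next
    have "matrix_action (mat 1) = (id :: 'K^('n + 'n) \<Rightarrow> _)"
      by (simp add: matrix_action_def fun_eq_iff)
    thus "W (matrix_action \<one>\<^bsub>SL_star cj\<^esub>) = id" by (simp add: SL_star_def W_id)
  qed
  show "representation (SL_star cj) (*s) \<rho>" by (rule representation_\<rho>)
  let ?T = "Hilbert_Choice.inv B"
  have BT: "B (?T v) = v" and TB: "?T (B u) = u" for u v
    using bij_B by (simp_all add: bij_is_inj bij_is_surj surj_f_inv_f)
  show "bij ?T" using bij_B by (rule bij_imp_bij_inv)
  show "Vector_Spaces.linear scale (*s) ?T"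
    unfolding Vector_Spaces.linear_iff
  proof (intro conjI allI)
    show "?T (u + v) = ?T u + ?T v" for u v
      using TB[of "?T u + ?T v"] by (simp only: B_simps BT)
    show "?T (scale a v) = a *s ?T v" for a v
      using TB[of "a *s ?T v"] by (simp only: B_simps BT)
  qed (rule vector_space_scale vec.vector_space_axioms)+
  fix A :: "'K^('n + 'n)^('n + 'n)"
  assume A: "A \<in> carrier (SL_star cj)"
  have "?T (W (matrix_action A) v) = \<rho> A (?T v)" for v
    using intertwines[OF A, of "?T v"] by (simp add: BT TB)
  thus "?T \<circ> W (matrix_action A) = \<rho> A \<circ> ?T" by (simp add: fun_eq_iff)
qed

end

theorem theorem6p1:
  fixes q :: nat
    and k :: "'K::{field,finite} set"
    and cj :: "'K \<Rightarrow> 'K"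
    and \<psi> \<phi> sg :: "'K \<Rightarrow> complex"
    and c :: complex
    and scale :: "complex \<Rightarrow> 'v::ab_group_add \<Rightarrow> 'v"
    and \<eta> :: "('K^('n::finite + 'n)) \<times> 'K \<Rightarrow> 'v \<Rightarrow> 'v"
    and W :: "('K^('n + 'n) \<Rightarrow> 'K^('n + 'n)) \<Rightarrow> 'v \<Rightarrow> 'v"
    and \<rho> :: "'K^('n + 'n)^('n + 'n) \<Rightarrow> complex^('K^'n) \<Rightarrow> complex^('K^'n)"
  assumes "primepow q" and "odd q" and "q > 3"
    and "CARD('K) = q\<^sup>2"
    and "is_subfield k" and "card k = q"
    and "nontrivial_automorphism_over k cj"
    and "additive_character \<psi>" and "\<exists>x. \<psi> x \<noteq> 1"
    and "\<forall>x. \<psi> x = \<psi> (cj x)"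
    and "additive_character \<phi>" and "\<forall>x. \<phi> (- 2 * x) = \<psi> x"
    and "nontrivial_quadratic_character sg"
    and "admissible_scalar q CARD('n) c"
    and "Weil_representation k cj \<phi> scale \<eta> W"
    and "generalized_Weil_representation cj sg \<psi> c \<rho>"
  shows "equivalent_representations (SL_star cj) scale (\<lambda>A. W (matrix_action A)) (*s) \<rho>"
proof -
  have "c \<noteq> 0"
    using assms by (auto simp: admissible_scalar_def)
  with assms interpret Weil_comparison k cj q \<psi> \<phi> scale \<eta> W sg c \<rho>
    by unfold_locales
  show ?thesis by (rule equivalent)
qed

end
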